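(* Let $p \in (1,\infty)$, $t\in [0,1]$, and let $\mu = \mu_1 \times \cdots \times \mu_n$ be a product measure on $\mathbb{R}^n$, where, for each $i = 1,\dots,n$, $\mu_i$ is a measure on $\mathbb{R}$ having a quasi-concave density with maximum at the origin. Then for any (non-empty) weakly unconditional measurable sets $A,B \subset \mathbb{R}^n$ such that $(1-t) \cdot_p A +_p t \cdot_p B$ is also measurable, one has $$\mu\big((1-t)\cdot_p A +_p t \cdot_p B\big)^{\frac{p}{n}} \geq (1-t)\, \mu(A)^{\frac{p}{n}} + t\, \mu(B)^{\frac{p}{n}}.$$
   Context: A set $A\subset\mathbb{R}^n$ is weakly unconditional if for every $x=(x_1,\dots,x_n)\in A$ and every $(\varepsilon_1,\dots,\varepsilon_n)\in\{0,1\}^n$ one has $(\varepsilon_1x_1,\dots,\varepsilon_nx_n)\in A$. A function $\phi\colon\mathbb{R}\to[0,\infty)$ is quasi-concave if $\phi((1-t)x+ty)\ge\min\{\phi(x),\phi(y)\}$ whenever $\phi(x)\phi(y)>0$ and $t\in[0,1]$. $L_p$-Minkowski combination: for non-empty measurable sets $A,B\subset\mathbb{R}^n$ and coefficients $\alpha,\beta\ge 0$, $$\alpha\cdot_p A+_p\beta\cdot_p B=\left\{\alpha^{\frac1p}(1-\lambda)^{\frac{p-1}{p}}x+\beta^{\frac1p}\lambda^{\frac{p-1}{p}}y\colon x\in A,\ y\in B,\ 0\le\lambda\le1\right\}.$$ *)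

theory Defs
  imports "HOL-Analysis.Analysis"
begin

definition weakly_unconditional :: "(real ^ 'n) set \<Rightarrow> bool" where
  "weakly_unconditional A \<longleftrightarrow>
     (\<forall>x\<in>A. \<forall>\<epsilon> :: real ^ 'n. (\<forall>i. \<epsilon> $ i \<in> {0, 1}) \<longrightarrow> (\<chi> i. \<epsilon> $ i * x $ i) \<in> A)"

definition quasi_concave :: "(real \<Rightarrow> real) \<Rightarrow> bool" where
  "quasi_concave \<phi> \<longleftrightarrow> (\<forall>x. 0 \<le> \<phi> x) \<and>
     (\<forall>x y t. \<phi> x * \<phi> y > 0 \<longrightarrow> t \<in> {0..1} \<longrightarrow>
        min (\<phi> x) (\<phi> y) \<le> \<phi> ((1 - t) * x + t * y))"

(* The set written \<alpha> \<cdot>\<^sub>p A +\<^sub>p \<beta> \<cdot>\<^sub>p B, intended for p > 1 and \<alpha>, \<beta> \<ge> 0.  Since 0 powr a = 0,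
   the conventions at \<lambda> = 0, \<lambda> = 1, \<alpha> = 0 and \<beta> = 0 are the usual ones. *)
definition Lp_combination ::
    "real \<Rightarrow> real \<Rightarrow> (real ^ 'n) set \<Rightarrow> real \<Rightarrow> (real ^ 'n) set \<Rightarrow> (real ^ 'n) set" where
  "Lp_combination p \<alpha> A \<beta> B =
     {(\<alpha> powr (1 / p) * (1 - l) powr ((p - 1) / p)) *\<^sub>R x +
      (\<beta> powr (1 / p) * l powr ((p - 1) / p)) *\<^sub>R y | x y l.
        x \<in> A \<and> y \<in> B \<and> 0 \<le> l \<and> l \<le> 1}"

(* The product \<mu>\<^sub>1 \<times> ... \<times> \<mu>\<^sub>n transported from functions to vectors and completed, so that
   for absolutely continuous factors it measures every Lebesgue measurable set
   (sets_lebesgue_subset_product_measure below). *)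
definition product_measure :: "('n::finite \<Rightarrow> real measure) \<Rightarrow> (real ^ 'n) measure" where
  "product_measure \<mu> = completion (distr (Pi\<^sub>M UNIV \<mu>) borel vec_lambda)"

(* Real powers of extended nonnegative reals, for exponents a > 0: \<infinity> to the power a is \<infinity>. *)
definition ennpowr :: "ennreal \<Rightarrow> real \<Rightarrow> ennreal" where
  "ennpowr x a = (if x = \<infinity> then \<infinity> else ennreal (enn2real x powr a))"

(* A quasi-concave function is automatically a legitimate density: it needs no separate
   measurability assumption. *)
lemma quasi_concave_borel_measurable:
  assumes "quasi_concave \<phi>"
  shows "\<phi> \<in> borel_measurable borel"
proof (rule borel_measurableI_greater)
  fix c :: real
  have "{x. c < \<phi> x} \<in> sets borel"
  proof (cases "c < 0")
    case True
    then have "{x. c < \<phi> x} = UNIV"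
      using assms unfolding quasi_concave_def by (auto intro: less_le_trans)
    then show ?thesis by simp
  next
    case False
    have "convex {x. c < \<phi> x}"
    proof (rule convexI)
      fix x y u v :: real
      assume *: "x \<in> {x. c < \<phi> x}" "y \<in> {x. c < \<phi> x}" "0 \<le> u" "0 \<le> v" "u + v = 1"
      then have "\<phi> x * \<phi> y > 0" using False by simp
      moreover have "u = 1 - v" "v \<in> {0..1}" using * by auto
      ultimately have "min (\<phi> x) (\<phi> y) \<le> \<phi> (u * x + v * y)"
        using assms unfolding quasi_concave_def by blast
      then show "u *\<^sub>R x + v *\<^sub>R y \<in> {x. c < \<phi> x}" using * by auto
    qed
    then have "is_interval {x. c < \<phi> x}"
      by (simp add: is_interval_convex_1)
    then show ?thesis
      by (rule real_interval_borel_measurable)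
  qed
  then show "{x \<in> space borel. c < \<phi> x} \<in> sets borel" by simp
qed

lemma measurable_vec_lambda_PiM:
  fixes \<mu> :: "'n::finite \<Rightarrow> real measure"
  assumes "\<And>i. sets (\<mu> i) = sets borel"
  shows "(vec_lambda :: _ \<Rightarrow> real ^ 'n) \<in> borel_measurable (Pi\<^sub>M UNIV \<mu>)"
proof (subst borel_measurable_euclidean_space, rule ballI)
  fix b :: "real ^ 'n" assume "b \<in> Basis"
  then obtain i where b: "b = axis i 1" by (auto simp: Basis_vec_def)
  have "(\<lambda>f. f i) \<in> measurable (Pi\<^sub>M UNIV \<mu>) (\<mu> i)"
    by (rule measurable_component_singleton) simp
  then have "(\<lambda>f. f i) \<in> borel_measurable (Pi\<^sub>M UNIV \<mu>)"
    using assms measurable_cong_sets by blast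
  then show "(\<lambda>f. (vec_lambda f :: real ^ 'n) \<bullet> b) \<in> borel_measurable (Pi\<^sub>M UNIV \<mu>)"
    by (simp add: b inner_axis)
qed

lemma distr_lborel_vec:
  "distr (Pi\<^sub>M UNIV (\<lambda>_. lborel)) borel vec_lambda = (lborel :: (real ^ 'n::finite) measure)"
proof (rule lborel_eqI[symmetric])
  fix l u :: "real ^ 'n"
  interpret product_sigma_finite "\<lambda>_::'n. lborel :: real measure" by standard
  assume lu: "\<And>b. b \<in> Basis \<Longrightarrow> l \<bullet> b \<le> u \<bullet> b"
  then have lu': "l $ i \<le> u $ i" for i
    using lu[of "axis i 1"] by (simp add: inner_axis axis_in_Basis_iff)
  have m: "(vec_lambda :: _ \<Rightarrow> real ^ 'n) \<in> measurable (Pi\<^sub>M UNIV (\<lambda>_. lborel)) borel"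
    by (rule measurable_vec_lambda_PiM) simp
  have "vec_lambda -` box l u \<inter> space (Pi\<^sub>M UNIV (\<lambda>_::'n. lborel)) = (\<Pi>\<^sub>E i\<in>UNIV. {l $ i <..< u $ i})"
    by (auto simp: mem_box_cart space_PiM PiE_iff)
  then have "emeasure (distr (Pi\<^sub>M UNIV (\<lambda>_. lborel)) borel vec_lambda) (box l u)
      = (\<Prod>i\<in>UNIV. emeasure lborel {l $ i <..< u $ i})"
    by (subst emeasure_distr[OF m]) (auto simp: emeasure_PiM)
  also have "\<dots> = (\<Prod>i\<in>UNIV. u $ i - l $ i)"
    by (simp add: lu' prod_ennreal del: emeasure_lborel_box)
  also have "(\<Prod>i\<in>UNIV. u $ i - l $ i) = (\<Prod>b\<in>Basis. (u - l) \<bullet> b)"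
  proof -
    have "inj (\<lambda>i::'n. axis i (1::real))" by (auto simp: inj_on_def axis_eq_axis)
    moreover have "(Basis :: (real ^ 'n) set) = range (\<lambda>i. axis i 1)" by (auto simp: Basis_vec_def)
    ultimately have "(\<Prod>b\<in>Basis. (u - l) \<bullet> b) = (\<Prod>i\<in>UNIV. (u - l) \<bullet> axis i 1)"
      by (rule prod.reindex_cong) simp
    then show ?thesis by (simp add: inner_axis)
  qed
  finally show "emeasure (distr (Pi\<^sub>M UNIV (\<lambda>_. lborel)) borel vec_lambda) (box l u)
      = (\<Prod>b\<in>Basis. (u - l) \<bullet> b)" .
qed simp

lemma PiM_density_lborel:
  fixes f :: "'n::finite \<Rightarrow> real \<Rightarrow> real"
  assumes [measurable]: "\<And>i. f i \<in> borel_measurable borel"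
  shows "Pi\<^sub>M UNIV (\<lambda>i. density lborel (\<lambda>x. ennreal (f i x))) =
    density (Pi\<^sub>M UNIV (\<lambda>_. lborel)) (\<lambda>x. \<Prod>i\<in>UNIV. ennreal (f i (x i)))"
proof (rule sym, rule product_sigma_finite.PiM_eqI)
  interpret L: product_sigma_finite "\<lambda>_::'n. lborel :: real measure" by standard
  show "product_sigma_finite (\<lambda>i. density lborel (\<lambda>x. ennreal (f i x)))"
    unfolding product_sigma_finite_def
    by (intro allI, subst sigma_finite_measure.sigma_finite_iff_density_finite[OF sigma_finite_lborel]) auto
  show "sets (density (Pi\<^sub>M UNIV (\<lambda>_. lborel)) (\<lambda>x. \<Prod>i\<in>UNIV. ennreal (f i (x i))))
      = sets (Pi\<^sub>M UNIV (\<lambda>i. density lborel (\<lambda>x. ennreal (f i x))))"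
    by (auto intro!: sets_PiM_cong)
  fix A :: "'n \<Rightarrow> real set"
  assume "\<And>i. i \<in> UNIV \<Longrightarrow> A i \<in> sets (density lborel (\<lambda>x. ennreal (f i x)))"
  then have A[measurable]: "\<And>i. A i \<in> sets borel" by simp
  have "emeasure (density (Pi\<^sub>M UNIV (\<lambda>_. lborel)) (\<lambda>x. \<Prod>i\<in>UNIV. ennreal (f i (x i)))) (Pi\<^sub>E UNIV A)
      = (\<integral>\<^sup>+x. (\<Prod>i\<in>UNIV. ennreal (f i (x i))) * indicator (Pi\<^sub>E UNIV A) x \<partial>Pi\<^sub>M UNIV (\<lambda>_. lborel))"
    by (rule emeasure_density) (auto intro!: sets_PiM_I_finite)
  also have "\<dots> = (\<integral>\<^sup>+x. (\<Prod>i\<in>UNIV. ennreal (f i (x i)) * indicator (A i) (x i)) \<partial>Pi\<^sub>M UNIV (\<lambda>_. lborel))"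
    by (intro nn_integral_cong) (auto simp: prod.distrib indicator_def PiE_def Pi_def)
  also have "\<dots> = (\<Prod>i\<in>UNIV. \<integral>\<^sup>+x. ennreal (f i x) * indicator (A i) x \<partial>lborel)"
    by (rule L.product_nn_integral_prod) auto
  also have "\<dots> = (\<Prod>i\<in>UNIV. emeasure (density lborel (\<lambda>x. ennreal (f i x))) (A i))"
    by (simp add: emeasure_density)
  finally show "emeasure (density (Pi\<^sub>M UNIV (\<lambda>_. lborel)) (\<lambda>x. \<Prod>i\<in>UNIV. ennreal (f i (x i)))) (Pi\<^sub>E UNIV A)
      = (\<Prod>i\<in>UNIV. emeasure (density lborel (\<lambda>x. ennreal (f i x))) (A i))" .
qed simp

lemma product_measure_density:
  fixes f :: "'n::finite \<Rightarrow> real \<Rightarrow> real"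
  assumes [measurable]: "\<And>i. f i \<in> borel_measurable borel"
  shows "product_measure (\<lambda>i. density lborel (\<lambda>x. ennreal (f i x))) =
    completion (density lborel (\<lambda>x. \<Prod>i\<in>UNIV. ennreal (f i (x $ i))))"
proof -
  have [measurable]: "(vec_lambda :: _ \<Rightarrow> real ^ 'n) \<in> borel_measurable (Pi\<^sub>M UNIV (\<lambda>_. lborel))"
    by (rule measurable_vec_lambda_PiM) simp
  have "(\<lambda>x :: real ^ 'n. \<Prod>i\<in>UNIV. ennreal (f i (x $ i))) \<in> borel_measurable borel"
    by measurable
  then have "density lborel (\<lambda>x. \<Prod>i\<in>UNIV. ennreal (f i (x $ i))) =
      distr (density (Pi\<^sub>M UNIV (\<lambda>_. lborel)) (\<lambda>x. \<Prod>i\<in>UNIV. ennreal (f i ((vec_lambda x :: real ^ 'n) $ i))))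
        borel vec_lambda"
    by (subst distr_lborel_vec[symmetric], subst density_distr) auto
  then show ?thesis
    unfolding product_measure_def by (simp add: PiM_density_lborel)
qed

lemma sets_lebesgue_subset_product_measure:
  fixes f :: "'n::finite \<Rightarrow> real \<Rightarrow> real"
  assumes [measurable]: "\<And>i. f i \<in> borel_measurable borel"
  shows "sets lebesgue \<subseteq> sets (product_measure (\<lambda>i. density lborel (\<lambda>x. ennreal (f i x))))"
proof
  fix A :: "(real ^ 'n) set" assume "A \<in> sets lebesgue"
  then obtain S N N' where A: "A = S \<union> N" "N \<subseteq> N'" "N' \<in> null_sets lborel" "S \<in> sets lborel"
    by (rule sets_completionE)
  have [measurable]: "(\<lambda>x :: real ^ 'n. \<Prod>i\<in>UNIV. ennreal (f i (x $ i))) \<in> borel_measurable lborel"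
    by measurable
  have "N' \<in> null_sets (density lborel (\<lambda>x. \<Prod>i\<in>UNIV. ennreal (f i (x $ i))))"
    using A(3) by (rule subsetD[OF absolutely_continuousI_density[unfolded absolutely_continuous_def], rotated]) measurable
  from sets_completionI[OF A(1,2) this] A(4)
  show "A \<in> sets (product_measure (\<lambda>i. density lborel (\<lambda>x. ennreal (f i x))))"
    unfolding product_measure_density[OF assms] by simp
qed

end

theory Submission
  imports Defs
begin

text \<open>
For a fixed parameter l between 0 and 1, the combination of A and B contains the linear combination
aA + bB with a = (1 - t) powr (1 / p) * (1 - l) powr ((p - 1) / p) and
b = t powr (1 / p) * l powr ((p - 1) / p), and a + b \<le> 1 by Young's inequality. So it suffices to
bound the measure of aA + bB from below for a suitable l. The bound used is multiplicative: the
measure of aA + bB is at least the product of \<mu>(A) powr (1 - l) * \<mu>(B) powr l and the n-th power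
of (a / (1 - l)) powr (1 - l) * (b / l) powr l. Writing U = (1 - t) * \<mu>(A) powr (p / n) and
V = t * \<mu>(B) powr (p / n), the choice l = V / (U + V) makes this lower bound equal to
(U + V) powr (n / p), which is the claim (optimal_mean_factor).

The multiplicative bound has the advantage that it passes from one dimension to products by
integrating out one coordinate at a time (geometric_mean_bound_product). In one dimension it concerns
functions f, g, h with h (a x + b y) bounded below by a constant times the geometric mean of f x and
g y. A general density would spoil it, but f and g have their maximum at the origin: this is what weak
unconditionality of a set says about its sections, and it survives integration. After normalising
both maxima to 1, the superlevel sets of f and g on each level below 1 contain the origin. For sets
that contain the origin there is the linear inequality
\<mu>(aX + bY) \<ge> a \<mu>(X) + b \<mu>(Y) (emeasure_combination_ge), because the superlevel sets of the
density are intervals containing 0 and hence closed under x, y \<mapsto> a x + b y when a + b \<le> 1, so that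
the classical inequality for lengths applies inside each of them. Integrating over the levels of f
and g and applying the weighted inequality of arithmetic and geometric mean gives the
one-dimensional bound (geometric_mean_bound_nn_integral).

The cases in which U or V is 0 or infinite follow from l = 0 and l = 1, where the combination
contains a contracted copy of A or of B. As aA + bB can fail to be measurable, A and B are first
replaced by weakly unconditional F-sigma subsets of full measure, whose linear combinations are
F-sigma sets.
\<close>

section \<open>The Brunn-Minkowski inequality on the line\<close>

lemma emeasure_lborel_scale:
  fixes X :: "real set"
  assumes "m \<noteq> 0" and X: "X \<in> sets borel"
  shows "(\<lambda>x. m * x) ` X \<in> sets borel"
    and "emeasure lborel ((\<lambda>x. m * x) ` X) = ennreal \<bar>m\<bar> * emeasure lborel X"
proof -
  have "(\<lambda>x. m * x) ` X = (\<lambda>x. x / m) -` X \<inter> space borel"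
    using \<open>m \<noteq> 0\<close> by (force simp: image_iff)
  also have "\<dots> \<in> sets borel"
    by (rule measurable_sets[OF _ X]) simp
  finally show meas: "(\<lambda>x. m * x) ` X \<in> sets borel" .
  show "emeasure lborel ((\<lambda>x. m * x) ` X) = ennreal \<bar>m\<bar> * emeasure lborel X"
    using emeasure_lebesgue_affine[of m 0 X] X meas by (simp add: emeasure_completion)
qed

text \<open>The points of the set itself serve as cut-off points. This replaces compactness in the
one-dimensional Brunn-Minkowski argument: the part of the set below one of its own points has a
largest element, and the measure of the set is the supremum of the measures of such parts.\<close>

lemma emeasure_lborel_le_SUP_atMost:
  fixes X :: "real set"
  assumes X: "X \<in> sets borel" and "X \<noteq> {}"
  shows "emeasure lborel X \<le> (SUP x\<in>X. emeasure lborel (X \<inter> {..x}))"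
proof -
  \<comment> \<open>A sequence of cut-offs dominated by points of the set; a maximum of the set may escape them,
    hence the extra null point.\<close>
  obtain u :: "nat \<Rightarrow> real" and s where u: "incseq u" "\<And>n. \<exists>x\<in>X. u n \<le> x"
    and cover: "X \<subseteq> (\<Union>n. {..u n}) \<union> {s}"
  proof (cases "bdd_above X")
    case True
    define u where "u n = Sup X - inverse (real (Suc n))" for n
    have "incseq u" unfolding u_def by (intro incseq_SucI) (simp add: field_simps)
    moreover have "\<exists>x\<in>X. u n \<le> x" for n
    proof -
      have "u n < Sup X" by (simp add: u_def)
      then show ?thesis using less_cSup_iff[OF \<open>X \<noteq> {}\<close> True] by (meson less_imp_le)
    qed
    moreover have "X \<subseteq> (\<Union>n. {..u n}) \<union> {Sup X}"
    proof
      fix x assume "x \<in> X"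
      then have "x \<le> Sup X" using True by (rule cSup_upper)
      show "x \<in> (\<Union>n. {..u n}) \<union> {Sup X}"
      proof (cases "x = Sup X")
        case False
        then have "0 < Sup X - x" using \<open>x \<le> Sup X\<close> by simp
        then obtain n where "inverse (real (Suc n)) < Sup X - x" by (rule reals_Archimedean[THEN exE])
        then have "x \<le> u n" unfolding u_def by simp
        then show ?thesis by auto
      qed simp
    qed
    ultimately show thesis by (rule that)
  next
    case False
    have "incseq real" by (simp add: incseq_def)
    moreover have "\<exists>x\<in>X. real n \<le> x" for n
      using False by (meson bdd_aboveI linear)
    moreover have "X \<subseteq> (\<Union>n. {..real n}) \<union> {0}"
      using real_arch_simple by auto
    ultimately show thesis by (rule that)
  qed
  have "emeasure lborel X \<le> emeasure lborel ((\<Union>n. X \<inter> {..u n}) \<union> {s})"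
    using X cover by (intro emeasure_mono) auto
  also have "\<dots> \<le> emeasure lborel (\<Union>n. X \<inter> {..u n}) + emeasure lborel {s}"
    using X by (intro emeasure_subadditive) auto
  also have "\<dots> = (SUP n. emeasure lborel (X \<inter> {..u n}))"
    using X u(1) by (subst SUP_emeasure_incseq) (auto simp: incseq_def intro: order_trans)
  also have "\<dots> \<le> (SUP x\<in>X. emeasure lborel (X \<inter> {..x}))"
  proof (rule SUP_least)
    fix n
    obtain x where "x \<in> X" "u n \<le> x" using u(2) by blast
    then have "emeasure lborel (X \<inter> {..u n}) \<le> emeasure lborel (X \<inter> {..x})"
      using X by (intro emeasure_mono) auto
    then show "emeasure lborel (X \<inter> {..u n}) \<le> (SUP x\<in>X. emeasure lborel (X \<inter> {..x}))"
      using \<open>x \<in> X\<close> by (rule SUP_upper2[rotated])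
  qed
  finally show ?thesis .
qed

lemma emeasure_lborel_le_SUP_atLeast:
  fixes Y :: "real set"
  assumes Y: "Y \<in> sets borel" and "Y \<noteq> {}"
  shows "emeasure lborel Y \<le> (SUP y\<in>Y. emeasure lborel (Y \<inter> {y..}))"
proof -
  have reflect: "emeasure lborel (uminus ` S) = emeasure lborel S" "uminus ` S \<in> sets borel"
    if "S \<in> sets borel" for S :: "real set"
    using emeasure_lborel_scale[of "-1" S] that by simp_all
  have cut: "uminus ` Y \<inter> {..-y} = uminus ` (Y \<inter> {y..})" for y by auto
  have "emeasure lborel Y = emeasure lborel (uminus ` Y)"
    using Y by (simp add: reflect)
  also have "\<dots> \<le> (SUP y\<in>uminus ` Y. emeasure lborel (uminus ` Y \<inter> {..y}))"
    using assms by (intro emeasure_lborel_le_SUP_atMost reflect) auto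
  also have "\<dots> = (SUP y\<in>Y. emeasure lborel (Y \<inter> {y..}))"
    using Y by (simp add: image_image cut reflect)
  finally show ?thesis .
qed

text \<open>For x in X and y in Y the translates of the part of X up to x by y, and of the part of
Y from y on by x, lie in Z on the two sides of x + y, so their lengths add up.
Then take suprema over x and y.\<close>

lemma brunn_minkowski_real:
  fixes X Y Z :: "real set"
  assumes XYZ[measurable]: "X \<in> sets borel" "Y \<in> sets borel" "Z \<in> sets borel"
    and ne: "X \<noteq> {}" "Y \<noteq> {}" and sum: "\<And>x y. x \<in> X \<Longrightarrow> y \<in> Y \<Longrightarrow> x + y \<in> Z"
  shows "emeasure lborel X + emeasure lborel Y \<le> emeasure lborel Z"
proof -
  have cut: "emeasure lborel (X \<inter> {..x}) + emeasure lborel (Y \<inter> {y..}) \<le> emeasure lborel Z"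
    if "x \<in> X" "y \<in> Y" for x y
  proof -
    have trans: "emeasure lborel ((+) c ` S) = emeasure lborel S" "(+) c ` S \<in> sets borel"
      if S: "S \<in> sets borel" for c :: real and S
    proof -
      have "(+) c ` S = (\<lambda>x. x - c) -` S \<inter> space borel"
        by (force simp: image_iff)
      also have "\<dots> \<in> sets borel"
        by (rule measurable_sets[OF _ S]) simp
      finally show meas: "(+) c ` S \<in> sets borel" .
      then show "emeasure lborel ((+) c ` S) = emeasure lborel S"
        using emeasure_lebesgue_affine[of 1 c S] S
        by (simp add: emeasure_completion add.commute[of _ c])
    qed
    define U V where "U = (+) y ` (X \<inter> {..x})" and "V = (+) x ` (Y \<inter> {y..})"
    have [measurable]: "U \<in> sets borel" "V \<in> sets borel"
      unfolding U_def V_def by (intro trans; measurable)+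
    have "emeasure lborel (X \<inter> {..x}) + emeasure lborel (Y \<inter> {y..}) = emeasure lborel U + emeasure lborel V"
      unfolding U_def V_def by (subst (1 2) trans(1)) auto
    also have "emeasure lborel U = emeasure lborel (U - {x + y})"
      by (rule emeasure_Diff_null_set[symmetric]) auto
    also have "emeasure lborel (U - {x + y}) + emeasure lborel V = emeasure lborel ((U - {x + y}) \<union> V)"
    proof (rule plus_emeasure)
      show "(U - {x + y}) \<inter> V = {}" by (auto simp: U_def V_def)
    qed auto
    also have "\<dots> \<le> emeasure lborel Z"
      using that sum by (intro emeasure_mono) (auto simp: U_def V_def add.commute[of y])
    finally show ?thesis .
  qed
  have "emeasure lborel X + emeasure lborel Y
      \<le> (SUP x\<in>X. emeasure lborel (X \<inter> {..x})) + (SUP y\<in>Y. emeasure lborel (Y \<inter> {y..}))"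
    using XYZ ne by (intro add_mono emeasure_lborel_le_SUP_atMost emeasure_lborel_le_SUP_atLeast)
  also have "\<dots> = (SUP x\<in>X. SUP y\<in>Y. emeasure lborel (X \<inter> {..x}) + emeasure lborel (Y \<inter> {y..}))"
    by (simp add: ennreal_SUP_add_left[OF ne(1), symmetric] ennreal_SUP_add_right[OF ne(2), symmetric])
  also have "\<dots> \<le> emeasure lborel Z"
    by (intro SUP_least cut)
  finally show ?thesis .
qed

section \<open>Layer cake formula\<close>

text \<open>The value 0 on non-positive levels lets integrals over all real levels stand for integrals
over the positive ones.\<close>

definition distribution_function :: "'a measure \<Rightarrow> ('a \<Rightarrow> ennreal) \<Rightarrow> real \<Rightarrow> ennreal" where
  "distribution_function M f s = indicator {0<..} s * emeasure M {x \<in> space M. ennreal s < f x}"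

lemma distribution_function_eq_nn_integral:
  assumes [measurable]: "f \<in> borel_measurable M"
  shows "distribution_function M f s = (\<integral>\<^sup>+x. (if 0 < s \<and> ennreal s < f x then 1 else 0) \<partial>M)"
proof -
  have "distribution_function M f s
      = (\<integral>\<^sup>+x. indicator {0<..} s * indicator {x \<in> space M. ennreal s < f x} x \<partial>M)"
    unfolding distribution_function_def by (simp add: nn_integral_cmult)
  also have "\<dots> = (\<integral>\<^sup>+x. (if 0 < s \<and> ennreal s < f x then 1 else 0) \<partial>M)"
    by (intro nn_integral_cong) (auto simp: indicator_def)
  finally show ?thesis .
qed

lemma measurable_distribution_function:
  assumes "sigma_finite_measure M" and [measurable]: "f \<in> borel_measurable M"
  shows "distribution_function M f \<in> borel_measurable borel"
proof -
  interpret sigma_finite_measure M by fact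
  have "(\<lambda>s. \<integral>\<^sup>+x. (if 0 < s \<and> ennreal s < f x then 1 else 0) \<partial>M) \<in> borel_measurable borel"
    by measurable
  then show ?thesis
    by (subst measurable_cong[OF distribution_function_eq_nn_integral]) auto
qed

lemma nn_integral_layer_cake:
  fixes f :: "'a \<Rightarrow> ennreal"
  assumes "sigma_finite_measure M" and f[measurable]: "f \<in> borel_measurable M"
  shows "(\<integral>\<^sup>+x. f x \<partial>M) = (\<integral>\<^sup>+s. distribution_function M f s \<partial>lborel)"
proof -
  interpret pair_sigma_finite M "lborel :: real measure"
    using assms(1) sigma_finite_lborel by (rule pair_sigma_finite.intro)
  \<comment> \<open>A value is the length of the set of positive levels below it; Fubini does the rest.\<close>
  have length: "v = (\<integral>\<^sup>+s. indicator {s. 0 < s \<and> ennreal s < v} s \<partial>lborel)" for v :: ennreal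
  proof (cases v rule: ennreal_cases)
    case (real r)
    then have "{s. 0 < s \<and> ennreal s < v} = {0<..<r}"
      by (auto simp: ennreal_less_iff)
    then show ?thesis using real by simp
  next
    case top
    then have "{s. 0 < s \<and> ennreal s < v} = {0<..}" by auto
    moreover have "emeasure lborel {0::real<..} = top"
    proof (rule ccontr)
      assume "emeasure lborel {0::real<..} \<noteq> top"
      then obtain r where r: "0 \<le> r" "emeasure lborel {0::real<..} = ennreal r"
        by (cases "emeasure lborel {0::real<..}" rule: ennreal_cases) auto
      have "ennreal (r + 1) = emeasure lborel {0<..<r + 1}"
        using r by simp
      also have "\<dots> \<le> emeasure lborel {0::real<..}"
        by (rule emeasure_mono) auto
      finally show False using r by simp
    qed
    ultimately show ?thesis using top by simp
  qed
  have "(\<integral>\<^sup>+x. f x \<partial>M) = (\<integral>\<^sup>+x. (\<integral>\<^sup>+s. indicator {s. 0 < s \<and> ennreal s < f x} s \<partial>lborel) \<partial>M)"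
    by (intro nn_integral_cong length)
  also have "\<dots> = (\<integral>\<^sup>+x. (\<integral>\<^sup>+s. (if 0 < s \<and> ennreal s < f x then 1 else 0) \<partial>lborel) \<partial>M)"
    by (simp add: indicator_def of_bool_def)
  also have "\<dots> = (\<integral>\<^sup>+s. (\<integral>\<^sup>+x. (if 0 < s \<and> ennreal s < f x then 1 else 0) \<partial>M) \<partial>lborel)"
    by (rule Fubini'[symmetric]) measurable
  finally show ?thesis
    by (simp add: distribution_function_eq_nn_integral)
qed

section \<open>One coordinate: quasi-concave densities with peak at the origin\<close>

text \<open>Superlevel sets are convex and contain the origin, so they absorb combinations whose coefficients
add up to at most 1: such a combination is a point of the segment from x to y, shrunk towards 0.\<close>

lemma superlevel_combination:
  assumes qc: "quasi_concave \<phi>" and peak: "\<And>x. \<phi> x \<le> \<phi> 0"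
    and ab: "0 \<le> a" "0 \<le> b" "a + b \<le> 1"
    and s: "0 \<le> s" "s < \<phi> x" "s < \<phi> y"
  shows "s < \<phi> (a * x + b * y)"
proof -
  have segment: "s < \<phi> ((1 - c) * u + c * v)" if "s < \<phi> u" "s < \<phi> v" "c \<in> {0..1}" for u v c
  proof -
    have "\<phi> u * \<phi> v > 0" using that s by simp
    then have "min (\<phi> u) (\<phi> v) \<le> \<phi> ((1 - c) * u + c * v)"
      using qc that(3) unfolding quasi_concave_def by blast
    then show ?thesis using that by simp
  qed
  have origin: "s < \<phi> 0" using s(2) peak[of x] by linarith
  show ?thesis
  proof (cases "a + b = 0")
    case True
    then show ?thesis using ab origin by (simp add: add_nonneg_eq_0_iff)
  next
    case False
    define w where "w = (a * x + b * y) / (a + b)"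
    have "s < \<phi> ((1 - b / (a + b)) * x + b / (a + b) * y)"
      using ab False s by (intro segment) auto
    moreover have "1 - b / (a + b) = a / (a + b)"
      using False by (simp add: field_simps)
    ultimately have "s < \<phi> w"
      by (simp add: w_def add_divide_distrib)
    then have "s < \<phi> ((1 - (a + b)) * 0 + (a + b) * w)"
      using ab origin by (intro segment) auto
    also have "(1 - (a + b)) * 0 + (a + b) * w = a * x + b * y"
      unfolding w_def using False by simp
    finally show ?thesis .
  qed
qed

locale peaked_density =
  fixes \<phi> :: "real \<Rightarrow> real" and M :: "real measure"
  assumes quasi_concave: "quasi_concave \<phi>" and peak: "\<phi> x \<le> \<phi> 0"
    and M_def: "M = density lborel (\<lambda>x. ennreal (\<phi> x))"
begin

lemma measurable_density[measurable]: "\<phi> \<in> borel_measurable borel"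
  by (rule quasi_concave_borel_measurable[OF quasi_concave])

lemma sets_M[simp, measurable_cong]: "sets M = sets borel"
  by (simp add: M_def)

lemma space_M[simp]: "space M = UNIV"
  by (simp add: M_def)

lemma sigma_finite_M: "sigma_finite_measure M"
  unfolding M_def
  by (subst sigma_finite_measure.sigma_finite_iff_density_finite[OF sigma_finite_lborel]) auto

lemma emeasure_M_superlevels:
  assumes [measurable]: "X \<in> sets borel"
  shows "emeasure M X = (\<integral>\<^sup>+s. indicator {0<..} s * emeasure lborel (X \<inter> {x. s < \<phi> x}) \<partial>lborel)"
    and "(\<lambda>s. indicator {0<..} s * emeasure lborel (X \<inter> {x. s < \<phi> x})) \<in> borel_measurable borel"
proof -
  let ?f = "\<lambda>x. ennreal (\<phi> x) * indicator X x"
  have level: "distribution_function lborel ?f = (\<lambda>s. indicator {0<..} s * emeasure lborel (X \<inter> {x. s < \<phi> x}))"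
  proof
    fix s :: real
    have "{x \<in> space lborel. ennreal s < ?f x} = X \<inter> {x. s < \<phi> x}" if "0 < s"
      using that by (auto simp: indicator_def ennreal_less_iff split: if_splits)
    then show "distribution_function lborel ?f s = indicator {0<..} s * emeasure lborel (X \<inter> {x. s < \<phi> x})"
      unfolding distribution_function_def by (cases "0 < s") auto
  qed
  have "emeasure M X = (\<integral>\<^sup>+x. ?f x \<partial>lborel)"
    unfolding M_def by (rule emeasure_density) auto
  then show "emeasure M X = (\<integral>\<^sup>+s. indicator {0<..} s * emeasure lborel (X \<inter> {x. s < \<phi> x}) \<partial>lborel)"
    by (simp add: nn_integral_layer_cake[OF sigma_finite_lborel] level)
  show "(\<lambda>s. indicator {0<..} s * emeasure lborel (X \<inter> {x. s < \<phi> x})) \<in> borel_measurable borel"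
    unfolding level[symmetric] by (rule measurable_distribution_function[OF sigma_finite_lborel]) measurable
qed

text \<open>Cut all three sets with a superlevel set of the density. Both cut sets still contain 0, so they are
non-empty, and the combination of the cut sets stays in the superlevel set; the inequality for
lengths therefore holds on every level, and integrating over the levels gives it for the measure.\<close>

lemma emeasure_combination_ge:
  assumes XYZ[measurable]: "X \<in> sets borel" "Y \<in> sets borel" "Z \<in> sets borel"
    and zero: "0 \<in> X" "0 \<in> Y"
    and ab: "0 < a" "0 < b" "a + b \<le> 1"
    and sum: "\<And>x y. x \<in> X \<Longrightarrow> y \<in> Y \<Longrightarrow> a * x + b * y \<in> Z"
  shows "ennreal a * emeasure M X + ennreal b * emeasure M Y \<le> emeasure M Z"
proof -
  note [measurable] = emeasure_M_superlevels(2)[OF XYZ(1)] emeasure_M_superlevels(2)[OF XYZ(2)]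
  have level: "ennreal a * emeasure lborel (X \<inter> {x. s < \<phi> x}) + ennreal b * emeasure lborel (Y \<inter> {x. s < \<phi> x})
      \<le> emeasure lborel (Z \<inter> {x. s < \<phi> x})" if "0 < s" for s
  proof (cases "s < \<phi> 0")
    case True
    let ?X = "X \<inter> {x. s < \<phi> x}" and ?Y = "Y \<inter> {x. s < \<phi> x}"
    have "ennreal a * emeasure lborel ?X + ennreal b * emeasure lborel ?Y
        = emeasure lborel ((\<lambda>x. a * x) ` ?X) + emeasure lborel ((\<lambda>x. b * x) ` ?Y)"
      using ab by (simp add: emeasure_lborel_scale)
    also have "\<dots> \<le> emeasure lborel (Z \<inter> {x. s < \<phi> x})"
    proof (rule brunn_minkowski_real)
      show "(\<lambda>x. a * x) ` ?X \<in> sets borel" "(\<lambda>x. b * x) ` ?Y \<in> sets borel"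
        using ab by (auto intro!: emeasure_lborel_scale(1))
      show "(\<lambda>x. a * x) ` ?X \<noteq> {}" "(\<lambda>x. b * x) ` ?Y \<noteq> {}"
        using zero True by auto
      show "u + v \<in> Z \<inter> {x. s < \<phi> x}" if "u \<in> (\<lambda>x. a * x) ` ?X" "v \<in> (\<lambda>x. b * x) ` ?Y" for u v
        using that sum ab \<open>0 < s\<close> superlevel_combination[OF quasi_concave peak, of a b s] by auto
    qed simp
    finally show ?thesis .
  next
    case False
    then have empty: "{x. s < \<phi> x} = {}" using peak by (auto simp: not_less intro: order_trans)
    show ?thesis unfolding empty by simp
  qed
  have "ennreal a * emeasure M X + ennreal b * emeasure M Y
      = (\<integral>\<^sup>+s. ennreal a * (indicator {0<..} s * emeasure lborel (X \<inter> {x. s < \<phi> x}))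
          + ennreal b * (indicator {0<..} s * emeasure lborel (Y \<inter> {x. s < \<phi> x})) \<partial>lborel)"
    by (simp add: emeasure_M_superlevels(1) nn_integral_cmult nn_integral_add)
  also have "\<dots> \<le> (\<integral>\<^sup>+s. indicator {0<..} s * emeasure lborel (Z \<inter> {x. s < \<phi> x}) \<partial>lborel)"
    using level by (intro nn_integral_mono) (auto simp: indicator_def)
  also have "\<dots> = emeasure M Z"
    by (simp add: emeasure_M_superlevels(1))
  finally show ?thesis .
qed

text \<open>The functional form of the previous inequality. The normalisation f 0 = g 0 = 1 is what makes it
linear: for every level s below 1 both superlevel sets contain 0, and for s at least 1 both are
empty, so the inequality for sets applies level by level.\<close>

lemma nn_integral_min_combination:
  fixes f g h :: "real \<Rightarrow> ennreal"
  assumes [measurable]: "f \<in> borel_measurable borel" "g \<in> borel_measurable borel" "h \<in> borel_measurable borel"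
    and f: "f 0 = 1" "\<And>x. f x \<le> 1" and g: "g 0 = 1" "\<And>y. g y \<le> 1"
    and ab: "0 < a" "0 < b" "a + b \<le> 1"
    and h: "\<And>x y. min (f x) (g y) \<le> h (a * x + b * y)"
  shows "ennreal a * (\<integral>\<^sup>+x. f x \<partial>M) + ennreal b * (\<integral>\<^sup>+y. g y \<partial>M) \<le> (\<integral>\<^sup>+z. h z \<partial>M)"
proof -
  have [measurable]: "distribution_function M k \<in> borel_measurable borel" if "k \<in> borel_measurable borel" for k
    using measurable_distribution_function[OF sigma_finite_M] that by simp
  have cake: "(\<integral>\<^sup>+x. k x \<partial>M) = (\<integral>\<^sup>+s. distribution_function M k s \<partial>lborel)"
    if "k \<in> borel_measurable borel" for k
    using nn_integral_layer_cake[OF sigma_finite_M] that by simp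
  have level: "ennreal a * distribution_function M f s + ennreal b * distribution_function M g s
      \<le> distribution_function M h s" for s
  proof (cases "0 < s \<and> s < 1")
    case True
    then have "ennreal s < 1" by (simp add: ennreal_less_one_iff)
    have "ennreal a * emeasure M {x. ennreal s < f x} + ennreal b * emeasure M {x. ennreal s < g x}
        \<le> emeasure M {x. ennreal s < h x}"
    proof (rule emeasure_combination_ge)
      show "a * x + b * y \<in> {z. ennreal s < h z}"
        if "x \<in> {x. ennreal s < f x}" "y \<in> {y. ennreal s < g y}" for x y
        using that less_le_trans[OF _ h[of x y], of "ennreal s"] by simp
    qed (use f g ab \<open>ennreal s < 1\<close> in auto)
    then show ?thesis using True by (simp add: distribution_function_def)
  next
    case False
    have "{x. ennreal s < f x} = {}" "{x. ennreal s < g x} = {}" if "0 < s"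
    proof -
      have "1 \<le> ennreal s" using False that by simp
      then have "\<not> ennreal s < f x" "\<not> ennreal s < g x" for x
        using f(2)[of x] g(2)[of x] by (meson leD order_trans)+
      then show "{x. ennreal s < f x} = {}" "{x. ennreal s < g x} = {}" by auto
    qed
    then show ?thesis by (cases "0 < s") (auto simp: distribution_function_def)
  qed
  have "ennreal a * (\<integral>\<^sup>+x. f x \<partial>M) + ennreal b * (\<integral>\<^sup>+y. g y \<partial>M)
      = (\<integral>\<^sup>+s. ennreal a * distribution_function M f s + ennreal b * distribution_function M g s \<partial>lborel)"
    by (simp add: cake nn_integral_cmult nn_integral_add)
  also have "\<dots> \<le> (\<integral>\<^sup>+s. distribution_function M h s \<partial>lborel)"
    by (intro nn_integral_mono level)
  finally show ?thesis by (simp add: cake)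
qed

end

section \<open>The multiplicative form\<close>

text \<open>This encodes k * (u powr (1 - l) * v powr l) \<le> w for extended values: the real numbers r and s
approximate u and v strictly from below. In this form the value \<infinity> needs no convention, and a
bound for all truncations of a function yields the bound for the function.\<close>

definition geometric_mean_bound ::
    "real \<Rightarrow> real \<Rightarrow> ennreal \<Rightarrow> ennreal \<Rightarrow> ennreal \<Rightarrow> bool" where
  "geometric_mean_bound k l u v w \<longleftrightarrow>
    (\<forall>r s. 0 < r \<longrightarrow> 0 < s \<longrightarrow> ennreal r < u \<longrightarrow> ennreal s < v \<longrightarrow>
      ennreal (k * (r powr (1 - l) * s powr l)) \<le> w)"

lemma geometric_mean_boundD:
  assumes "geometric_mean_bound k l u v w" "0 < r" "0 < s" "ennreal r < u" "ennreal s < v"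
  shows "ennreal (k * (r powr (1 - l) * s powr l)) \<le> w"
  using assms unfolding geometric_mean_bound_def by blast

text \<open>The constant in the weighted inequality between arithmetic and geometric mean, when the weights
a and b need not add up to 1.\<close>

definition mean_factor :: "real \<Rightarrow> real \<Rightarrow> real \<Rightarrow> real" where
  "mean_factor l a b = (a / (1 - l)) powr (1 - l) * (b / l) powr l"

lemma mean_factor_pos: "0 < l \<Longrightarrow> l < 1 \<Longrightarrow> 0 < a \<Longrightarrow> 0 < b \<Longrightarrow> 0 < mean_factor l a b"
  by (simp add: mean_factor_def)

lemma mean_factor_le:
  assumes "0 < l" "l < 1" "0 < a" "0 < b" "0 < x" "0 < y"
  shows "mean_factor l a b * (x powr (1 - l) * y powr l) \<le> a * x + b * y"
proof -
  have "mean_factor l a b * (x powr (1 - l) * y powr l)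
      = (a / (1 - l) * x) powr (1 - l) * (b / l * y) powr l"
    using assms powr_mult[of "a / (1 - l)" x "1 - l"] powr_mult[of "b / l" y l]
    by (simp only: mean_factor_def) (simp add: mult_ac)
  also have "\<dots> \<le> (1 - l) * (a / (1 - l) * x) + l * (b / l * y)"
    using assms by (intro Youngs_inequality_0) auto
  also have "\<dots> = a * x + b * y"
    using assms by simp
  finally show ?thesis .
qed

context peaked_density begin

text \<open>Dividing f and g by their values F and G at the origin, and h by the corresponding mean K, turns the
hypothesis into the one of the linear inequality. The weighted inequality of arithmetic and
geometric mean then makes its conclusion multiplicative, which brings in the factor
mean_factor l a b, and F and G cancel.\<close>

lemma geometric_mean_bound_nn_integral_bounded:
  fixes f g h :: "real \<Rightarrow> ennreal" and a b k l F G :: real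
  assumes [measurable]: "f \<in> borel_measurable borel" "g \<in> borel_measurable borel" "h \<in> borel_measurable borel"
    and f: "f 0 = ennreal F" "0 < F" "\<And>x. f x \<le> ennreal F"
    and g: "g 0 = ennreal G" "0 < G" "\<And>y. g y \<le> ennreal G"
    and ab: "0 < a" "0 < b" "a + b \<le> 1" and l: "0 < l" "l < 1" and k: "0 < k"
    and h: "\<And>x y. geometric_mean_bound k l (f x) (g y) (h (a * x + b * y))"
  shows "geometric_mean_bound (k * mean_factor l a b) l (\<integral>\<^sup>+x. f x \<partial>M) (\<integral>\<^sup>+y. g y \<partial>M) (\<integral>\<^sup>+z. h z \<partial>M)"
  unfolding geometric_mean_bound_def
proof (intro allI impI)
  fix r s :: real
  assume rs: "0 < r" "0 < s" "ennreal r < (\<integral>\<^sup>+x. f x \<partial>M)" "ennreal s < (\<integral>\<^sup>+y. g y \<partial>M)"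
  define K where "K = k * (F powr (1 - l) * G powr l)"
  have K: "0 < K" using f g k by (simp add: K_def)
  have "ennreal a * (\<integral>\<^sup>+x. ennreal (1 / F) * f x \<partial>M) + ennreal b * (\<integral>\<^sup>+y. ennreal (1 / G) * g y \<partial>M)
      \<le> (\<integral>\<^sup>+z. ennreal (1 / K) * h z \<partial>M)"
  proof (rule nn_integral_min_combination)
    show "ennreal (1 / F) * f 0 = 1" "ennreal (1 / G) * g 0 = 1"
      using f g by (simp_all add: ennreal_mult'[symmetric])
    show "ennreal (1 / F) * f x \<le> 1" for x
    proof -
      have "ennreal (1 / F) * f x \<le> ennreal (1 / F) * ennreal F" by (intro mult_left_mono f) simp
      then show ?thesis using f by (simp add: ennreal_mult'[symmetric])
    qed
    show "ennreal (1 / G) * g x \<le> 1" for x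
    proof -
      have "ennreal (1 / G) * g x \<le> ennreal (1 / G) * ennreal G" by (intro mult_left_mono g) simp
      then show ?thesis using g by (simp add: ennreal_mult'[symmetric])
    qed
    have above: "ennreal (u * c) < v" if "ennreal u < ennreal (1 / c) * v" "0 < c" "0 < u" for u c v
    proof (cases v rule: ennreal_cases)
      case (real w)
      then show ?thesis
        using that by (simp add: ennreal_mult'[symmetric] ennreal_less_iff field_simps)
    qed simp
    \<comment> \<open>If u is below both normalised values, then the bound with r = u * F and s = u * G reads
      K * u \<le> h.\<close>
    show "min (ennreal (1 / F) * f x) (ennreal (1 / G) * g y) \<le> ennreal (1 / K) * h (a * x + b * y)" for x y
    proof (rule dense_le)
      fix w assume w: "w < min (ennreal (1 / F) * f x) (ennreal (1 / G) * g y)"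
      then have "w < top" using less_top_ennreal by (meson min_less_iff_conj order_less_le_trans top_greatest)
      then obtain u where u: "w = ennreal u" "0 \<le> u"
        by (cases w rule: ennreal_cases) auto
      show "w \<le> ennreal (1 / K) * h (a * x + b * y)"
      proof (cases "u = 0")
        case False
        then have "0 < u" using u by simp
        have "ennreal (k * ((u * F) powr (1 - l) * (u * G) powr l)) \<le> h (a * x + b * y)"
          using \<open>0 < u\<close> f g w u by (intro geometric_mean_boundD[OF h] above) auto
        also have "k * ((u * F) powr (1 - l) * (u * G) powr l) = K * (u powr (1 - l) * u powr l)"
          using \<open>0 < u\<close> f g by (simp add: K_def powr_mult)
        also have "u powr (1 - l) * u powr l = u"
          using \<open>0 < u\<close> by (simp add: powr_add[symmetric])
        finally have "ennreal (1 / K) * ennreal (K * u) \<le> ennreal (1 / K) * h (a * x + b * y)"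
          by (intro mult_left_mono) auto
        then show ?thesis using K u by (simp add: ennreal_mult'[symmetric])
      qed (simp add: u)
    qed
  qed (use ab in auto)
  then have main: "ennreal a * (ennreal (1 / F) * (\<integral>\<^sup>+x. f x \<partial>M)) + ennreal b * (ennreal (1 / G) * (\<integral>\<^sup>+y. g y \<partial>M))
      \<le> ennreal (1 / K) * (\<integral>\<^sup>+z. h z \<partial>M)"
    by (simp add: nn_integral_cmult)
  have "mean_factor l a b * ((r / F) powr (1 - l) * (s / G) powr l) \<le> a * (r / F) + b * (s / G)"
    using mean_factor_le[of l a b "r / F" "s / G"] l ab rs f g by simp
  then have "ennreal (mean_factor l a b * ((r / F) powr (1 - l) * (s / G) powr l)) \<le> ennreal (a * (r / F) + b * (s / G))"
    by (rule ennreal_leI)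
  also have "\<dots> = ennreal a * (ennreal (1 / F) * ennreal r) + ennreal b * (ennreal (1 / G) * ennreal s)"
    using ab f g rs by (simp add: ennreal_mult'[symmetric] ennreal_plus[symmetric] del: ennreal_plus)
  also have "\<dots> \<le> ennreal a * (ennreal (1 / F) * (\<integral>\<^sup>+x. f x \<partial>M)) + ennreal b * (ennreal (1 / G) * (\<integral>\<^sup>+y. g y \<partial>M))"
    using rs by (intro add_mono mult_left_mono) auto
  also note main
  finally have "ennreal K * ennreal (mean_factor l a b * ((r / F) powr (1 - l) * (s / G) powr l))
      \<le> ennreal K * (ennreal (1 / K) * (\<integral>\<^sup>+z. h z \<partial>M))"
    by (intro mult_left_mono) auto
  also have "\<dots> = (\<integral>\<^sup>+z. h z \<partial>M)"
    using K by (simp add: mult.assoc[symmetric] ennreal_mult'[symmetric])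
  also have "ennreal K * ennreal (mean_factor l a b * ((r / F) powr (1 - l) * (s / G) powr l))
      = ennreal (k * mean_factor l a b * (r powr (1 - l) * s powr l))"
    using K f g rs by (simp add: ennreal_mult'[symmetric] K_def powr_divide mult_ac)
  finally show "ennreal (k * mean_factor l a b * (r powr (1 - l) * s powr l)) \<le> (\<integral>\<^sup>+z. h z \<partial>M)" .
qed

text \<open>Unbounded functions occur as marginals of sets of infinite measure. Truncation keeps the maximum at
the origin and preserves the hypothesis, since it only makes the left-hand side smaller.\<close>

lemma geometric_mean_bound_nn_integral:
  fixes f g h :: "real \<Rightarrow> ennreal" and a b k l :: real
  assumes [measurable]: "f \<in> borel_measurable borel" "g \<in> borel_measurable borel" "h \<in> borel_measurable borel"
    and f: "\<And>x. f x \<le> f 0" and g: "\<And>y. g y \<le> g 0"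
    and ab: "0 < a" "0 < b" "a + b \<le> 1" and l: "0 < l" "l < 1" and k: "0 < k"
    and h: "\<And>x y. geometric_mean_bound k l (f x) (g y) (h (a * x + b * y))"
  shows "geometric_mean_bound (k * mean_factor l a b) l (\<integral>\<^sup>+x. f x \<partial>M) (\<integral>\<^sup>+y. g y \<partial>M) (\<integral>\<^sup>+z. h z \<partial>M)"
  unfolding geometric_mean_bound_def
proof (intro allI impI)
  fix r s :: real
  assume rs: "0 < r" "0 < s" "ennreal r < (\<integral>\<^sup>+x. f x \<partial>M)" "ennreal s < (\<integral>\<^sup>+y. g y \<partial>M)"
  have truncate: "(\<integral>\<^sup>+x. e x \<partial>M) = (SUP n::nat. \<integral>\<^sup>+x. min (e x) (ennreal n) \<partial>M)"
    if [measurable]: "e \<in> borel_measurable borel" for e :: "real \<Rightarrow> ennreal"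
  proof -
    have "(SUP n::nat. min v (ennreal n)) = v" for v
    proof -
      have "(SUP n::nat. ennreal n) = top"
        using ennreal_SUP_of_nat_eq_top unfolding ennreal_of_nat_eq_real_of_nat .
      then show ?thesis
        unfolding inf_min[symmetric] inf_SUP[symmetric] by (simp only: inf_top_right)
    qed
    then have "(\<integral>\<^sup>+x. e x \<partial>M) = (\<integral>\<^sup>+x. (SUP n::nat. min (e x) (ennreal n)) \<partial>M)"
      by simp
    also have "\<dots> = (SUP n::nat. \<integral>\<^sup>+x. min (e x) (ennreal n) \<partial>M)"
      by (intro nn_integral_monotone_convergence_SUP)
        (auto simp: incseq_def le_fun_def intro: min.coboundedI2 ennreal_leI)
    finally show ?thesis .
  qed
  have nonzero: "e 0 \<noteq> 0" if "\<And>x. e x \<le> e 0" "ennreal q < (\<integral>\<^sup>+x. e x \<partial>M)" for e q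
  proof
    assume "e 0 = 0"
    then have "e x = 0" for x using that(1)[of x] by simp
    then show False using that(2) by simp
  qed
  obtain m where m: "ennreal r < (\<integral>\<^sup>+x. min (f x) (ennreal (real m)) \<partial>M)"
    using rs(3) by (subst (asm) truncate) (auto simp: less_SUP_iff)
  obtain n where n: "ennreal s < (\<integral>\<^sup>+x. min (g x) (ennreal (real n)) \<partial>M)"
    using rs(4) by (subst (asm) truncate) (auto simp: less_SUP_iff)
  have "m \<noteq> 0" "n \<noteq> 0" using m n by (auto intro!: gr0I)
  have top: "\<exists>F. min v (ennreal (real j)) = ennreal F \<and> 0 < F" if "v \<noteq> 0" "j \<noteq> 0" for v j
    using that by (cases v rule: ennreal_cases) (auto simp: min_def ennreal_le_iff top_unique intro: exI[of _ "real j"])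
  obtain F where F: "min (f 0) (ennreal (real m)) = ennreal F" "0 < F"
    using top nonzero[OF f rs(3)] \<open>m \<noteq> 0\<close> by blast
  obtain G where G: "min (g 0) (ennreal (real n)) = ennreal G" "0 < G"
    using top nonzero[OF g rs(4)] \<open>n \<noteq> 0\<close> by blast
  have "geometric_mean_bound (k * mean_factor l a b) l
      (\<integral>\<^sup>+x. min (f x) (ennreal (real m)) \<partial>M) (\<integral>\<^sup>+y. min (g y) (ennreal (real n)) \<partial>M) (\<integral>\<^sup>+z. h z \<partial>M)"
  proof (rule geometric_mean_bound_nn_integral_bounded)
    show "min (f x) (ennreal (real m)) \<le> ennreal F" "min (g x) (ennreal (real n)) \<le> ennreal G" for x
      unfolding F(1)[symmetric] G(1)[symmetric] using f g by (auto intro: min.coboundedI1)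
    show "geometric_mean_bound k l (min (f x) (ennreal (real m))) (min (g y) (ennreal (real n))) (h (a * x + b * y))" for x y
      using h[of x y] unfolding geometric_mean_bound_def by auto
  qed (use F G ab l k in auto)
  then show "ennreal (k * mean_factor l a b * (r powr (1 - l) * s powr l)) \<le> (\<integral>\<^sup>+z. h z \<partial>M)"
    using rs m n by (intro geometric_mean_boundD)
qed

end

section \<open>Product measures\<close>

text \<open>Induction on the number of coordinates, as for the Prekopa-Leindler inequality: integrating out one
coordinate by the one-dimensional inequality gives marginals that satisfy the same hypotheses with
k replaced by k * mean_factor l a b. The monotonicity assumption is the functional form of weak
unconditionality; it puts the maximum of every one-dimensional section at the origin, and it is
inherited by marginals.\<close>

lemma geometric_mean_bound_product:
  fixes \<phi> :: "'i \<Rightarrow> real \<Rightarrow> real" and M :: "'i \<Rightarrow> real measure" and a b l :: real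
  assumes dens: "\<And>i. peaked_density (\<phi> i) (M i)"
    and ab: "0 < a" "0 < b" "a + b \<le> 1" and l: "0 < l" "l < 1" and "finite I"
  shows "\<lbrakk>f \<in> borel_measurable (Pi\<^sub>M I M); g \<in> borel_measurable (Pi\<^sub>M I M); h \<in> borel_measurable (Pi\<^sub>M I M);
      \<And>x i. x \<in> extensional I \<Longrightarrow> i \<in> I \<Longrightarrow> f x \<le> f (x(i := 0));
      \<And>x i. x \<in> extensional I \<Longrightarrow> i \<in> I \<Longrightarrow> g x \<le> g (x(i := 0)); 0 < k;
      \<And>x y z. x \<in> extensional I \<Longrightarrow> y \<in> extensional I \<Longrightarrow> z \<in> extensional I \<Longrightarrow>
        (\<And>i. i \<in> I \<Longrightarrow> z i = a * x i + b * y i) \<Longrightarrow> geometric_mean_bound k l (f x) (g y) (h z)\<rbrakk>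
    \<Longrightarrow> geometric_mean_bound (k * mean_factor l a b ^ card I) l
      (\<integral>\<^sup>+x. f x \<partial>Pi\<^sub>M I M) (\<integral>\<^sup>+x. g x \<partial>Pi\<^sub>M I M) (\<integral>\<^sup>+x. h x \<partial>Pi\<^sub>M I M)"
  using \<open>finite I\<close>
proof (induction I arbitrary: f g h k rule: finite_induct)
  case empty
  have "geometric_mean_bound k l (f (\<lambda>_. undefined)) (g (\<lambda>_. undefined)) (h (\<lambda>_. undefined))"
    by (rule empty.prems(7)) auto
  then show ?case
    by (simp add: PiM_empty nn_integral_count_space_finite)
next
  case (insert i I)
  interpret product_sigma_finite M
    unfolding product_sigma_finite_def using dens by (auto intro: peaked_density.sigma_finite_M)
  interpret peaked_density "\<phi> i" "M i" by (rule dens)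
  have [simp]: "sets (M i) = sets borel" for i
    using dens by (rule peaked_density.sets_M)
  note [measurable] = insert.prems(1-3)
  let ?marginal = "\<lambda>f x. \<integral>\<^sup>+u. f (x(i := u)) \<partial>M i"
  have "geometric_mean_bound (k * mean_factor l a b * mean_factor l a b ^ card I) l
      (\<integral>\<^sup>+x. ?marginal f x \<partial>Pi\<^sub>M I M) (\<integral>\<^sup>+x. ?marginal g x \<partial>Pi\<^sub>M I M) (\<integral>\<^sup>+x. ?marginal h x \<partial>Pi\<^sub>M I M)"
  proof (rule insert.IH)
    have swap: "x(i := u, j := 0) = x(j := 0, i := u)" if "j \<in> I" for x :: "'i \<Rightarrow> real" and j u
      using that insert.hyps by (auto intro: fun_upd_twist)
    have update: "x(i := u) \<in> extensional (insert i I)" if "x \<in> extensional I" for x :: "'i \<Rightarrow> real" and u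
      using that by (auto simp: extensional_def)
    show "?marginal f x \<le> ?marginal f (x(j := 0))" "?marginal g x \<le> ?marginal g (x(j := 0))"
      if "x \<in> extensional I" "j \<in> I" for x j
      unfolding swap[OF that(2), symmetric] using that update
      by (auto intro!: nn_integral_mono insert.prems(4,5))
    show "?marginal f \<in> borel_measurable (Pi\<^sub>M I M)" "?marginal g \<in> borel_measurable (Pi\<^sub>M I M)"
      "?marginal h \<in> borel_measurable (Pi\<^sub>M I M)"
      by measurable
    show "0 < k * mean_factor l a b" using insert.prems(6) ab l by (simp add: mean_factor_pos)
    show "geometric_mean_bound (k * mean_factor l a b) l (?marginal f x) (?marginal g y) (?marginal h z)"
      if ext: "x \<in> extensional I" "y \<in> extensional I" "z \<in> extensional I"
        and z: "\<And>i. i \<in> I \<Longrightarrow> z i = a * x i + b * y i" for x y z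
    proof (rule geometric_mean_bound_nn_integral)
      show "f (x(i := u)) \<le> f (x(i := 0))" "g (y(i := u)) \<le> g (y(i := 0))" for u
      proof -
        have "f (x(i := u)) \<le> f (x(i := u, i := 0))" "g (y(i := u)) \<le> g (y(i := u, i := 0))"
          by (intro insert.prems(4,5) update ext; simp)+
        then show "f (x(i := u)) \<le> f (x(i := 0))" "g (y(i := u)) \<le> g (y(i := 0))" by simp_all
      qed
      show "geometric_mean_bound k l (f (x(i := u))) (g (y(i := v))) (h (z(i := a * u + b * v)))" for u v
        using z insert.hyps by (intro insert.prems(7) update ext) auto
      have slice: "(\<lambda>u. e (w(i := u))) \<in> borel_measurable borel"
        if e: "e \<in> borel_measurable (Pi\<^sub>M (insert i I) M)" and w: "w \<in> extensional I" for e :: "('i \<Rightarrow> real) \<Rightarrow> ennreal" and w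
      proof -
        have "w \<in> space (Pi\<^sub>M I M)"
          using w by (simp add: space_PiM PiE_def peaked_density.space_M[OF dens])
        then have "(\<lambda>u. w(i := u)) \<in> measurable (M i) (Pi\<^sub>M (insert i I) M)"
          using insert.hyps by (intro measurable_component_update) auto
        from measurable_compose[OF this e] show ?thesis
          by (simp cong: measurable_cong_sets)
      qed
      show "(\<lambda>u. f (x(i := u))) \<in> borel_measurable borel" "(\<lambda>u. g (y(i := u))) \<in> borel_measurable borel"
        "(\<lambda>u. h (z(i := u))) \<in> borel_measurable borel"
        using ext insert.prems(1-3) by (auto intro: slice)
    qed (use ab l insert.prems(6) in auto)
  qed
  then show ?case
    using insert.hyps by (simp add: product_nn_integral_insert mult.assoc)
qed

text \<open>For finite u and v the approximation from below can be removed: take r = c * u and s = c * v, which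
multiplies the mean by c, and let c tend to 1.\<close>

lemma geometric_mean_bound_real:
  assumes bound: "geometric_mean_bound k l (ennreal u) (ennreal v) w" and "0 < u" "0 < v" "0 < k"
  shows "ennreal (k * (u powr (1 - l) * v powr l)) \<le> w"
proof (cases w rule: ennreal_cases)
  case (real m)
  have "k * (u powr (1 - l) * v powr l) \<le> m"
  proof (rule field_le_mult_one_interval)
    fix c :: real assume c: "0 < c" "c < 1"
    have "c powr (1 - l) * c powr l = c"
      using c by (simp add: powr_add[symmetric])
    moreover have "(c * u) powr (1 - l) * (c * v) powr l = (c powr (1 - l) * c powr l) * (u powr (1 - l) * v powr l)"
      using assms c by (simp add: powr_mult mult_ac)
    ultimately have "(c * u) powr (1 - l) * (c * v) powr l = c * (u powr (1 - l) * v powr l)"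
      by (simp only:)
    then have "c * (k * (u powr (1 - l) * v powr l)) = k * ((c * u) powr (1 - l) * (c * v) powr l)"
      by (simp only: mult.left_commute)
    moreover have "ennreal (k * ((c * u) powr (1 - l) * (c * v) powr l)) \<le> w"
      using assms c by (intro geometric_mean_boundD[OF bound]) (auto simp: ennreal_less_iff)
    ultimately show "c * (k * (u powr (1 - l) * v powr l)) \<le> m"
      by (simp only: real(2) ennreal_le_iff[OF real(1)])
  qed
  then show ?thesis using real by (simp add: ennreal_leI)
qed simp

section \<open>Weakly unconditional sets\<close>

lemma weakly_unconditional_zero_coordinate:
  assumes "weakly_unconditional A" and "x \<in> A"
  shows "(\<chi> j. if j = i then 0 else x $ j) \<in> A"
proof -
  let ?e = "(\<chi> j. if j = i then 0 else 1) :: real ^ 'a"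
  have "(\<chi> j. ?e $ j * x $ j) \<in> A"
    using assms(1)[unfolded weakly_unconditional_def, rule_format, OF assms(2), of ?e] by simp
  moreover have "(\<chi> j. ?e $ j * x $ j) = (\<chi> j. if j = i then 0 else x $ j)"
    by (simp add: vec_eq_iff)
  ultimately show ?thesis by simp
qed

text \<open>Products and continuous images of countable unions of compact sets are of the same kind. This is
where the class of F-sigma sets is better behaved than the class of Borel sets.\<close>

lemma fsigma_image2:
  fixes f :: "'a::euclidean_space \<Rightarrow> 'b::euclidean_space \<Rightarrow> 'c::euclidean_space"
  assumes "fsigma S" "fsigma T" and f: "continuous_on UNIV (\<lambda>z. f (fst z) (snd z))"
  shows "fsigma ((\<lambda>z. f (fst z) (snd z)) ` (S \<times> T))"
proof -
  obtain F G :: "nat \<Rightarrow> _" where F: "range F \<subseteq> Collect compact" "S = \<Union>(range F)"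
    and G: "range G \<subseteq> Collect compact" "T = \<Union>(range G)"
    using assms unfolding fsigma_Union_compact by blast
  let ?H = "\<lambda>k. (\<lambda>z. f (fst z) (snd z)) ` (F (fst (prod_decode k)) \<times> G (snd (prod_decode k)))"
  have "compact (?H k)" for k
    using F(1) G(1) by (intro compact_continuous_image compact_Times continuous_on_subset[OF f]) auto
  moreover have "(\<lambda>z. f (fst z) (snd z)) ` (S \<times> T) = \<Union>(range ?H)"
  proof -
    have "S \<times> T = (\<Union>k. F (fst (prod_decode k)) \<times> G (snd (prod_decode k)))"
    proof (intro set_eqI iffI)
      fix z assume "z \<in> S \<times> T"
      then obtain m n where "fst z \<in> F m" "snd z \<in> G n" using F(2) G(2) by auto
      then show "z \<in> (\<Union>k. F (fst (prod_decode k)) \<times> G (snd (prod_decode k)))"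
        by (intro UN_I[of "prod_encode (m, n)"]) (auto simp: mem_Times_iff)
    qed (use F(2) G(2) in auto)
    then show ?thesis by (simp only: image_UN)
  qed
  ultimately show ?thesis
    unfolding fsigma_Union_compact by (intro exI[of _ ?H]) auto
qed

lemma fsigma_imp_borel: "fsigma S \<Longrightarrow> S \<in> sets borel"
  by (induction rule: fsigma.induct) auto

lemma fsigma_insert:
  fixes S :: "'a::t1_space set"
  assumes "fsigma S"
  shows "fsigma (insert x S)"
  using assms
proof cases
  case (1 F)
  then show ?thesis using fsigma.intros[of "\<lambda>n. insert x (F n)"] by simp
qed

text \<open>An F-sigma subset of full measure need not be weakly unconditional, but its orbit under the
coordinate projections is, stays inside A, and is again an F-sigma set. A point x0 of A is thrown in
to keep the core non-empty when A is a null set.\<close>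

lemma weakly_unconditional_fsigma_core:
  fixes A :: "(real ^ 'n::finite) set"
  assumes "A \<in> sets lebesgue" and wu: "weakly_unconditional A" and "A \<noteq> {}"
  obtains S where "fsigma S" "weakly_unconditional S" "S \<noteq> {}" "S \<subseteq> A" "A - S \<in> null_sets lebesgue"
proof -
  obtain C N where C: "fsigma C" and N: "N \<in> null_sets lebesgue" and CN: "C \<union> N = A"
    using lebesgue_set_almost_fsigma[OF assms(1)] by metis
  obtain x0 where "x0 \<in> A" using \<open>A \<noteq> {}\<close> by blast
  define E where "E = {e :: real ^ 'n. \<forall>i. e $ i \<in> {0, 1}}"
  define mask where "mask e x = (\<chi> i. e $ i * x $ i)" for e x :: "real ^ 'n"
  define S where "S = (\<lambda>z. mask (fst z) (snd z)) ` (E \<times> (insert x0 C))"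
  have "closed E"
    unfolding E_def by (simp, intro closed_Collect_all closed_Collect_disj closed_Collect_eq continuous_intros)
  have 1: "fsigma S"
    unfolding S_def
  proof (rule fsigma_image2)
    show "fsigma E" using fsigma.intros[of "\<lambda>_. E"] \<open>closed E\<close> by simp
    show "fsigma (insert x0 C)" using C by (rule fsigma_insert)
    show "continuous_on UNIV (\<lambda>z. mask (fst z) (snd z))"
      unfolding mask_def by (intro continuous_intros)
  qed
  have one: "(\<chi> i. 1) \<in> E" and mask_one: "mask (\<chi> i. 1) x = x" for x
    by (simp_all add: E_def mask_def)
  have 2: "insert x0 C \<subseteq> S"
  proof
    fix x assume "x \<in> insert x0 C"
    with one have "mask (\<chi> i. 1) x \<in> S"
      unfolding S_def by (intro image_eqI[of _ _ "((\<chi> i. 1), x)"]) auto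
    then show "x \<in> S" by (simp only: mask_one)
  qed
  have 3: "S \<subseteq> A"
  proof -
    have "mask e x \<in> A" if "e \<in> E" "x \<in> A" for e x
      using wu that unfolding mask_def E_def weakly_unconditional_def by blast
    moreover have "insert x0 C \<subseteq> A" using CN \<open>x0 \<in> A\<close> by blast
    ultimately show ?thesis unfolding S_def by auto
  qed
  have 4: "weakly_unconditional S"
    unfolding weakly_unconditional_def
  proof (intro ballI allI impI)
    fix x e :: "real ^ 'n" assume "x \<in> S" and e: "\<forall>i. e $ i \<in> {0, 1}"
    then obtain d y where x: "x = mask d y" "d \<in> E" "y \<in> insert x0 C" unfolding S_def by auto
    have "mask e d \<in> E"
      unfolding E_def
    proof (intro CollectI allI)
      fix i
      have "e $ i \<in> {0, 1}" "d $ i \<in> {0, 1}" using e x(2) by (auto simp: E_def)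
      then show "mask e d $ i \<in> {0, 1}" by (auto simp: mask_def)
    qed
    then have "mask (mask e d) y \<in> S" unfolding S_def using x(3)
      by (intro image_eqI[of _ _ "(mask e d, y)"]) auto
    then show "(\<chi> i. e $ i * x $ i) \<in> S" by (simp add: x(1) mask_def mult.assoc)
  qed
  have "A - S \<in> null_sets lebesgue"
  proof (rule null_sets_completion_subset[OF _ N])
    show "A - S \<subseteq> N" using 2 CN by auto
  qed
  with 1 4 3 2 show thesis by (intro that) auto
qed

lemma emeasure_product_measure_borel:
  fixes \<mu> :: "'n::finite \<Rightarrow> real measure"
  assumes "\<And>i. sets (\<mu> i) = sets borel" and X: "X \<in> sets borel"
  shows "emeasure (product_measure \<mu>) X = (\<integral>\<^sup>+x. indicator X (vec_lambda x) \<partial>Pi\<^sub>M UNIV \<mu>)"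
    and "(\<lambda>x. indicator X (vec_lambda x) :: ennreal) \<in> borel_measurable (Pi\<^sub>M UNIV \<mu>)"
proof -
  have [measurable]: "(vec_lambda :: _ \<Rightarrow> real ^ 'n) \<in> borel_measurable (Pi\<^sub>M UNIV \<mu>)"
    using assms(1) by (rule measurable_vec_lambda_PiM)
  note [measurable] = X
  have "emeasure (product_measure \<mu>) X = (\<integral>\<^sup>+x. indicator X x \<partial>distr (Pi\<^sub>M UNIV \<mu>) borel vec_lambda)"
    unfolding product_measure_def using X by simp
  also have "\<dots> = (\<integral>\<^sup>+x. indicator X (vec_lambda x) \<partial>Pi\<^sub>M UNIV \<mu>)"
    by (rule nn_integral_distr) auto
  finally show "emeasure (product_measure \<mu>) X = (\<integral>\<^sup>+x. indicator X (vec_lambda x) \<partial>Pi\<^sub>M UNIV \<mu>)" .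
  show "(\<lambda>x. indicator X (vec_lambda x) :: ennreal) \<in> borel_measurable (Pi\<^sub>M UNIV \<mu>)"
    by measurable
qed

text \<open>For indicator functions the hypothesis of the product bound holds with k = 1: numbers r and s below
the indicators exist only at points of S and T, where r, s < 1 have a mean of at most 1 while the
indicator of Z is 1.\<close>

lemma geometric_mean_bound_sets:
  fixes \<mu> :: "'n::finite \<Rightarrow> real measure" and S T Z :: "(real ^ 'n) set"
  assumes dens: "\<And>i. peaked_density (\<phi> i) (\<mu> i)"
    and sets: "S \<in> sets borel" "T \<in> sets borel" "Z \<in> sets borel"
    and wu: "weakly_unconditional S" "weakly_unconditional T"
    and ab: "0 < a" "0 < b" "a + b \<le> 1" and l: "0 < l" "l < 1"
    and Z: "\<And>x y. x \<in> S \<Longrightarrow> y \<in> T \<Longrightarrow> a *\<^sub>R x + b *\<^sub>R y \<in> Z"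
  shows "geometric_mean_bound (mean_factor l a b ^ CARD('n)) l
    (emeasure (product_measure \<mu>) S) (emeasure (product_measure \<mu>) T) (emeasure (product_measure \<mu>) Z)"
proof -
  have \<mu>: "sets (\<mu> i) = sets borel" for i
    using dens by (rule peaked_density.sets_M)
  have mono: "indicator X (vec_lambda x) \<le> (indicator X (vec_lambda (x(i := 0))) :: ennreal)"
    if "weakly_unconditional X" for X :: "(real ^ 'n) set" and x i
  proof -
    have "vec_lambda (x(i := 0)) = (\<chi> j. if j = i then 0 else vec_lambda x $ j)"
      by (simp add: vec_eq_iff)
    then show ?thesis
      using weakly_unconditional_zero_coordinate[OF that, of "vec_lambda x" i] by (auto simp: indicator_def)
  qed
  have "geometric_mean_bound (1 * mean_factor l a b ^ card (UNIV :: 'n set)) l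
      (\<integral>\<^sup>+x. indicator S (vec_lambda x) \<partial>Pi\<^sub>M UNIV \<mu>) (\<integral>\<^sup>+x. indicator T (vec_lambda x) \<partial>Pi\<^sub>M UNIV \<mu>)
      (\<integral>\<^sup>+x. indicator Z (vec_lambda x) \<partial>Pi\<^sub>M UNIV \<mu>)"
  proof (rule geometric_mean_bound_product[OF dens ab l])
    fix x y z :: "'n \<Rightarrow> real"
    assume z: "\<And>i. i \<in> UNIV \<Longrightarrow> z i = a * x i + b * y i"
    show "geometric_mean_bound 1 l (indicator S (vec_lambda x)) (indicator T (vec_lambda y)) (indicator Z (vec_lambda z))"
      unfolding geometric_mean_bound_def
    proof (intro allI impI)
      fix r s :: real
      assume rs: "0 < r" "0 < s" "ennreal r < indicator S (vec_lambda x)" "ennreal s < indicator T (vec_lambda y)"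
      then have mem: "vec_lambda x \<in> S" "vec_lambda y \<in> T"
        by (auto simp: indicator_def split: if_splits intro: ccontr)
      then have "r < 1" "s < 1"
        using rs by (simp_all add: ennreal_less_one_iff)
      have "vec_lambda z = a *\<^sub>R vec_lambda x + b *\<^sub>R vec_lambda y"
        using z by (simp add: vec_eq_iff)
      then have "vec_lambda z \<in> Z" using Z[OF mem] by simp
      moreover have "r powr (1 - l) * s powr l \<le> 1 * 1"
        using rs l \<open>r < 1\<close> \<open>s < 1\<close> by (intro mult_mono powr_le1) auto
      ultimately show "ennreal (1 * (r powr (1 - l) * s powr l)) \<le> indicator Z (vec_lambda z)"
        by simp
    qed
  qed (use mono wu in \<open>auto intro!: emeasure_product_measure_borel(2) \<mu> sets\<close>)
  then show ?thesis by (simp add: emeasure_product_measure_borel(1)[OF \<mu>] sets)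
qed

lemma (in peaked_density) density_le_scaled:
  assumes "0 \<le> c" "c \<le> 1"
  shows "\<phi> x \<le> \<phi> (c * x)"
proof (cases "0 < \<phi> x")
  case True
  then have "0 < \<phi> 0 * \<phi> x" using peak[of x] by simp
  then have "min (\<phi> 0) (\<phi> x) \<le> \<phi> ((1 - c) * 0 + c * x)"
    using quasi_concave assms unfolding quasi_concave_def by (meson atLeastAtMost_iff)
  then show ?thesis using peak[of x] by simp
next
  case False
  then show ?thesis using quasi_concave unfolding quasi_concave_def by (meson not_less order_trans)
qed

text \<open>Contracting towards the origin can only increase the density, so a contraction loses at most the
factor that it loses for Lebesgue measure. This covers the endpoints l = 0 and l = 1, where the
multiplicative bound degenerates.\<close>

lemma emeasure_product_measure_scale_ge:
  fixes \<mu> :: "'n::finite \<Rightarrow> real measure" and S Z :: "(real ^ 'n) set"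
  assumes dens: "\<And>i. peaked_density (\<phi> i) (\<mu> i)"
    and sets[measurable]: "S \<in> sets borel" "Z \<in> sets borel"
    and c: "0 \<le> c" "c \<le> 1" and Z: "\<And>x. x \<in> S \<Longrightarrow> c *\<^sub>R x \<in> Z"
  shows "ennreal (c ^ CARD('n)) * emeasure (product_measure \<mu>) S \<le> emeasure (product_measure \<mu>) Z"
proof (cases "c = 0")
  case False
  then have "0 < c" using c by simp
  have [measurable]: "\<phi> i \<in> borel_measurable borel" for i
    using dens by (rule peaked_density.measurable_density)
  have \<mu>: "\<mu> = (\<lambda>i. density lborel (\<lambda>x. ennreal (\<phi> i x)))"
    using peaked_density.M_def[OF dens] by auto
  let ?D = "\<lambda>x :: real ^ 'n. \<Prod>i\<in>UNIV. ennreal (\<phi> i (x $ i))"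
  have [measurable]: "?D \<in> borel_measurable borel" by measurable
  have em: "emeasure (product_measure \<mu>) X = (\<integral>\<^sup>+x. ?D x * indicator X x \<partial>lborel)" if "X \<in> sets borel" for X
    unfolding \<mu> using that by (subst product_measure_density) (auto simp: emeasure_density)
  have "ennreal (c ^ CARD('n)) * emeasure (product_measure \<mu>) S
      = (\<integral>\<^sup>+x. ennreal (c ^ CARD('n)) * (?D x * indicator S x) \<partial>lborel)"
    by (simp add: em sets nn_integral_cmult)
  also have "\<dots> \<le> (\<integral>\<^sup>+x. ennreal (c ^ CARD('n)) * (?D (c *\<^sub>R x) * indicator Z (c *\<^sub>R x)) \<partial>lborel)"
  proof (intro nn_integral_mono mult_left_mono mult_mono)
    show "?D x \<le> ?D (c *\<^sub>R x)" for x
    proof -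
      have "0 \<le> \<phi> i v" for i v
        using peaked_density.quasi_concave[OF dens] by (simp add: quasi_concave_def)
      then show ?thesis
        using peaked_density.density_le_scaled[OF dens c]
        by (auto simp: prod_ennreal intro!: ennreal_leI prod_mono)
    qed
    show "indicator S x \<le> (indicator Z (c *\<^sub>R x) :: ennreal)" for x
      using Z by (auto simp: indicator_def)
  qed auto
  also have "\<dots> = (\<integral>\<^sup>+x. ?D x * indicator Z x \<partial>density (distr lborel borel (\<lambda>x. 0 + c *\<^sub>R x)) (\<lambda>_. \<bar>c\<bar> ^ DIM(real ^ 'n)))"
    using \<open>0 < c\<close> by (simp add: nn_integral_density nn_integral_distr)
  also have "\<dots> = (\<integral>\<^sup>+x. ?D x * indicator Z x \<partial>lborel)"
    using lborel_affine[OF False, of "0 :: real ^ 'n"] by simp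
  also have "\<dots> = emeasure (product_measure \<mu>) Z"
    by (simp add: em sets)
  finally show ?thesis .
qed (simp add: power_0_left)

section \<open>The choice of the coefficients\<close>

lemma Lp_coefficients_sum_le_1:
  fixes p t l :: real
  assumes "1 < p" "0 < t" "t < 1" "0 < l" "l < 1"
  shows "(1 - t) powr (1 / p) * (1 - l) powr ((p - 1) / p) + t powr (1 / p) * l powr ((p - 1) / p) \<le> 1"
proof -
  have conj: "1 / p + (p - 1) / p = 1" using assms by (simp add: add_divide_distrib[symmetric])
  have "(1 - t) powr (1 / p) * (1 - l) powr ((p - 1) / p) \<le> 1 / p * (1 - t) + (p - 1) / p * (1 - l)"
    using assms conj by (intro Youngs_inequality_0) auto
  moreover have "t powr (1 / p) * l powr ((p - 1) / p) \<le> 1 / p * t + (p - 1) / p * l"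
    using assms conj by (intro Youngs_inequality_0) auto
  moreover have "c * (1 - t) + d * (1 - l) + (c * t + d * l) = c + d" for c d
    by (simp add: algebra_simps)
  note this[of "1 / p" "(p - 1) / p"]
  ultimately show ?thesis using conj by linarith
qed

text \<open>Since 1 - (p - 1) / p = 1 / p, dividing the coefficient by m leaves (s / m) powr (1 / p).\<close>

lemma Lp_coefficient_power:
  fixes n :: nat
  assumes "0 < p" "0 < n" "0 < s" "0 < m" "0 < u"
  shows "(s powr (1 / p) * m powr ((p - 1) / p) / m) ^ n * u = (s * u powr (p / n) / m) powr (n / p)"
proof -
  have "m powr ((p - 1) / p) / m = m powr ((p - 1) / p - 1)"
    using assms by (simp add: powr_diff)
  also have "(p - 1) / p - 1 = - (1 / p)" using assms by (simp add: field_simps)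
  finally have "m powr ((p - 1) / p) / m = 1 / m powr (1 / p)"
    by (simp add: powr_minus_divide)
  then have "s powr (1 / p) * m powr ((p - 1) / p) / m = (s / m) powr (1 / p)"
    by (simp only: times_divide_eq_right[symmetric]) (simp add: powr_divide)
  then have "(s powr (1 / p) * m powr ((p - 1) / p) / m) ^ n = (s / m) powr (n / p)"
    using assms by (simp add: powr_power)
  moreover have "u = (u powr (p / n)) powr (n / p)"
    using assms by (simp add: powr_powr)
  ultimately have "(s powr (1 / p) * m powr ((p - 1) / p) / m) ^ n * u
      = (s / m) powr (n / p) * (u powr (p / n)) powr (n / p)"
    by simp
  also have "\<dots> = (s / m * u powr (p / n)) powr (n / p)"
    by (rule powr_mult[symmetric])
  finally show ?thesis by (simp only: times_divide_eq_left)
qed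

text \<open>With l = V / (U + V) the two weights satisfy U / (1 - l) = U + V = V / l, so both factors of the
geometric mean equal (U + V) powr (n / p), and so does the mean: for this l nothing is lost.\<close>

lemma optimal_mean_factor:
  fixes n :: nat
  assumes p: "0 < p" and n: "0 < n" and t: "0 < t" "t < 1" and uv: "0 < u" "0 < v"
    and U: "U = (1 - t) * u powr (p / n)" and V: "V = t * v powr (p / n)" and l: "l = V / (U + V)"
  shows "mean_factor l ((1 - t) powr (1 / p) * (1 - l) powr ((p - 1) / p))
        (t powr (1 / p) * l powr ((p - 1) / p)) ^ n * (u powr (1 - l) * v powr l) = (U + V) powr (n / p)"
    (is "mean_factor l ?a ?b ^ n * _ = _")
proof -
  have pos: "0 < U" "0 < V" using t uv by (simp_all add: U V)
  then have l': "1 - l = U / (U + V)" "0 < 1 - l" "0 < l" by (simp_all add: l field_simps)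
  have "U / (1 - l) = U + V" "V / l = U + V" using pos unfolding l'(1) by (simp_all add: l)
  then have a: "(?a / (1 - l)) ^ n * u = (U + V) powr (n / p)" and b: "(?b / l) ^ n * v = (U + V) powr (n / p)"
    using Lp_coefficient_power[of p n "1 - t" "1 - l" u] Lp_coefficient_power[of p n t l v] p n t uv l'(2,3) U V
    by simp_all
  have "mean_factor l ?a ?b ^ n * (u powr (1 - l) * v powr l)
      = ((?a / (1 - l)) ^ n * u) powr (1 - l) * ((?b / l) ^ n * v) powr l"
  proof -
    have split: "(x ^ n * w) powr e = (x powr e) ^ n * w powr e" if "0 < x" "0 < w" for x w e :: real
    proof -
      have "(x ^ n) powr e = x powr (real n * e)"
        unfolding powr_realpow[OF that(1), symmetric] powr_powr ..
      then show ?thesis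
        using that by (simp add: powr_mult powr_power)
    qed
    have "0 < ?a / (1 - l)" "0 < ?b / l" using t l'(2,3) by simp_all
    then show ?thesis
      by (simp only: mean_factor_def power_mult_distrib split[OF _ uv(1)] split[OF _ uv(2)])
        (simp only: mult_ac)
  qed
  also have "\<dots> = (U + V) powr (n / p)"
    unfolding a b using pos by (simp add: powr_add[symmetric])
  finally show ?thesis .
qed

section \<open>The Lp Brunn-Minkowski inequality\<close>

lemma ennpowr_mono:
  assumes "0 \<le> q" "x \<le> y"
  shows "ennpowr x q \<le> ennpowr y q"
proof (cases y rule: ennreal_cases)
  case (real r)
  moreover from this assms obtain s where "x = ennreal s" "0 \<le> s"
    by (cases x rule: ennreal_cases) (auto simp: top_unique)
  ultimately show ?thesis
    using assms by (auto simp: ennpowr_def intro!: ennreal_leI powr_mono2)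
qed (simp add: ennpowr_def)

lemma ennpowr_ennreal: "0 \<le> x \<Longrightarrow> ennpowr (ennreal x) q = ennreal (x powr q)"
  by (simp add: ennpowr_def)

lemma ennpowr_scale:
  assumes "0 < c"
  shows "ennpowr (ennreal c * x) q = ennreal (c powr q) * ennpowr x q"
proof (cases x rule: ennreal_cases)
  case (real r)
  then show ?thesis
    using assms by (simp add: ennreal_mult'[symmetric] ennpowr_ennreal powr_mult)
next
  case top
  then show ?thesis
    using assms by (simp add: ennpowr_def ennreal_mult_top)
qed

lemma ennpowr_scaled_power_le:
  fixes n :: nat
  assumes "0 < p" "0 < n" "0 \<le> s" and le: "ennreal ((s powr (1 / p)) ^ n) * x \<le> y"
  shows "ennreal s * ennpowr x (p / n) \<le> ennpowr y (p / n)"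
proof (cases "s = 0")
  case False
  then have "0 < s" using assms by simp
  then have "((s powr (1 / p)) ^ n) powr (p / n) = s"
    using assms by (simp add: powr_power powr_powr)
  then have "ennreal s * ennpowr x (p / n) = ennpowr (ennreal ((s powr (1 / p)) ^ n) * x) (p / n)"
    using \<open>0 < s\<close> by (subst ennpowr_scale) auto
  also have "\<dots> \<le> ennpowr y (p / n)"
    using assms by (intro ennpowr_mono le) auto
  finally show ?thesis .
qed simp

lemma Lp_combination_mono:
  assumes "S \<subseteq> A" "T \<subseteq> B"
  shows "Lp_combination p \<alpha> S \<beta> T \<subseteq> Lp_combination p \<alpha> A \<beta> B"
proof
  fix z assume "z \<in> Lp_combination p \<alpha> S \<beta> T"
  then obtain x y l where "x \<in> S" "y \<in> T" "0 \<le> l" "l \<le> 1"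
    and z: "z = (\<alpha> powr (1 / p) * (1 - l) powr ((p - 1) / p)) *\<^sub>R x
      + (\<beta> powr (1 / p) * l powr ((p - 1) / p)) *\<^sub>R y"
    unfolding Lp_combination_def by auto
  then have "x \<in> A" "y \<in> B" using assms by auto
  then show "z \<in> Lp_combination p \<alpha> A \<beta> B"
    unfolding Lp_combination_def using z \<open>0 \<le> l\<close> \<open>l \<le> 1\<close> by blast
qed

text \<open>The value l = 0 gives the first summand alone as a lower bound, and l = 1 the second. This settles
the cases in which a summand is 0 or \<infinity>; otherwise both measures are finite and positive and
t lies strictly between 0 and 1, so the optimal l lies strictly between 0 and 1 as well.\<close>

lemma brunn_minkowski_Lp_fsigma:
  fixes \<mu> :: "'n::finite \<Rightarrow> real measure" and S T C :: "(real ^ 'n) set"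
  assumes dens: "\<And>i. peaked_density (\<phi> i) (\<mu> i)" and p: "1 < p" and t: "0 \<le> t" "t \<le> 1"
    and S: "fsigma S" "weakly_unconditional S" "S \<noteq> {}"
    and T: "fsigma T" "weakly_unconditional T" "T \<noteq> {}"
    and C: "Lp_combination p (1 - t) S t T \<subseteq> C" "C \<in> sets (product_measure \<mu>)"
  shows "ennreal (1 - t) * ennpowr (emeasure (product_measure \<mu>) S) (p / CARD('n))
      + ennreal t * ennpowr (emeasure (product_measure \<mu>) T) (p / CARD('n))
    \<le> ennpowr (emeasure (product_measure \<mu>) C) (p / CARD('n))"
proof -
  let ?P = "product_measure \<mu>" and ?n = "CARD('n)"
  define a where "a l = (1 - t) powr (1 / p) * (1 - l) powr ((p - 1) / p)" for l
  define b where "b l = t powr (1 / p) * l powr ((p - 1) / p)" for l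
  define Z where "Z l = (\<lambda>z. a l *\<^sub>R fst z + b l *\<^sub>R snd z) ` (S \<times> T)" for l
  have "fsigma (Z l)" for l
    unfolding Z_def by (rule fsigma_image2[OF S(1) T(1)]) (intro continuous_intros)
  then have Z_sets: "Z l \<in> sets borel" for l
    by (rule fsigma_imp_borel)
  have in_Z: "a l *\<^sub>R x + b l *\<^sub>R y \<in> Z l" if "x \<in> S" "y \<in> T" for l x y
    unfolding Z_def using that by (intro image_eqI[of _ _ "(x, y)"]) auto
  have "Z l \<subseteq> C" if "0 \<le> l" "l \<le> 1" for l
  proof
    fix z assume "z \<in> Z l"
    then obtain x y where "x \<in> S" "y \<in> T" "z = a l *\<^sub>R x + b l *\<^sub>R y"
      unfolding Z_def by auto
    then have "z \<in> Lp_combination p (1 - t) S t T"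
      unfolding Lp_combination_def a_def b_def using that by blast
    then show "z \<in> C" using C(1) by blast
  qed
  then have Z_le: "emeasure ?P (Z l) \<le> emeasure ?P C" if "0 \<le> l" "l \<le> 1" for l
    using C(2) that by (intro emeasure_mono)
  have SS: "S \<in> sets borel" "T \<in> sets borel"
    using S(1) T(1) by (auto intro: fsigma_imp_borel)
  have left: "ennreal (1 - t) * ennpowr (emeasure ?P S) (p / ?n) \<le> ennpowr (emeasure ?P C) (p / ?n)"
  proof (rule ennpowr_scaled_power_le)
    obtain y where "y \<in> T" using T(3) by blast
    have "ennreal (((1 - t) powr (1 / p)) ^ ?n) * emeasure ?P S \<le> emeasure ?P (Z 0)"
    proof (rule emeasure_product_measure_scale_ge[OF dens SS(1) Z_sets])
      show "(1 - t) powr (1 / p) *\<^sub>R x \<in> Z 0" if "x \<in> S" for x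
        using in_Z[OF that \<open>y \<in> T\<close>, of 0] by (simp add: a_def b_def)
    qed (use t p in \<open>auto intro: powr_le1\<close>)
    also note Z_le
    finally show "ennreal (((1 - t) powr (1 / p)) ^ ?n) * emeasure ?P S \<le> emeasure ?P C" by simp
  qed (use p t in auto)
  have right: "ennreal t * ennpowr (emeasure ?P T) (p / ?n) \<le> ennpowr (emeasure ?P C) (p / ?n)"
  proof (rule ennpowr_scaled_power_le)
    obtain x where "x \<in> S" using S(3) by blast
    have "ennreal ((t powr (1 / p)) ^ ?n) * emeasure ?P T \<le> emeasure ?P (Z 1)"
    proof (rule emeasure_product_measure_scale_ge[OF dens SS(2) Z_sets])
      show "t powr (1 / p) *\<^sub>R y \<in> Z 1" if "y \<in> T" for y
        using in_Z[OF \<open>x \<in> S\<close> that, of 1] by (simp add: a_def b_def)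
    qed (use t p in \<open>auto intro: powr_le1\<close>)
    also note Z_le
    finally show "ennreal ((t powr (1 / p)) ^ ?n) * emeasure ?P T \<le> emeasure ?P C" by simp
  qed (use p t in auto)
  let ?L = "ennreal (1 - t) * ennpowr (emeasure ?P S) (p / ?n)"
  let ?R = "ennreal t * ennpowr (emeasure ?P T) (p / ?n)"
  consider "?L = 0 \<or> ?R = 0" | "?L = top \<or> ?R = top" | "?L \<noteq> 0" "?R \<noteq> 0" "?L \<noteq> top" "?R \<noteq> top"
    by blast
  then show ?thesis
  proof cases
    case 1
    then show ?thesis using left right by auto
  next
    case 2
    then show ?thesis using left right by (auto simp: top_unique)
  next
    case 3
    have real: "\<exists>u>0. x = ennreal u" if "ennreal c * ennpowr x q \<noteq> 0" "ennreal c * ennpowr x q \<noteq> top" for x c q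
      using that
      by (cases x rule: ennreal_cases) (auto simp: ennpowr_def ennreal_mult_eq_top_iff less_le)
    obtain u where u: "0 < u" "emeasure ?P S = ennreal u" using real[OF 3(1,3)] by blast
    obtain v where v: "0 < v" "emeasure ?P T = ennreal v" using real[OF 3(2,4)] by blast
    have t': "0 < t" "t < 1" using 3 t by (auto simp: less_le)
    define U where "U = (1 - t) * u powr (p / ?n)"
    define V where "V = t * v powr (p / ?n)"
    define l where "l = V / (U + V)"
    have UV: "0 < U" "0 < V" using t' u v by (simp_all add: U_def V_def)
    then have l: "0 < l" "l < 1" by (simp_all add: l_def)
    have ab: "0 < a l" "0 < b l" using t' l by (simp_all add: a_def b_def)
    have "geometric_mean_bound (mean_factor l (a l) (b l) ^ ?n) l (emeasure ?P S) (emeasure ?P T) (emeasure ?P (Z l))"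
    proof (rule geometric_mean_bound_sets[OF dens SS Z_sets S(2) T(2) ab _ l in_Z])
      show "a l + b l \<le> 1"
        unfolding a_def b_def using p t' l by (rule Lp_coefficients_sum_le_1)
    qed
    then have "ennreal (mean_factor l (a l) (b l) ^ ?n * (u powr (1 - l) * v powr l)) \<le> emeasure ?P (Z l)"
      unfolding u(2) v(2) using u(1) v(1) mean_factor_pos[OF l ab] by (intro geometric_mean_bound_real) auto
    also have "mean_factor l (a l) (b l) ^ ?n * (u powr (1 - l) * v powr l) = (U + V) powr (?n / p)"
      unfolding a_def b_def using p t' u v
      by (intro optimal_mean_factor) (auto simp: U_def V_def l_def)
    also have "emeasure ?P (Z l) \<le> emeasure ?P C"
      using l by (intro Z_le) auto
    finally have "ennpowr (ennreal ((U + V) powr (?n / p))) (p / ?n) \<le> ennpowr (emeasure ?P C) (p / ?n)"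
      using p by (intro ennpowr_mono) auto
    moreover have "ennpowr (ennreal ((U + V) powr (?n / p))) (p / ?n) = ennreal (U + V)"
      using p UV by (simp add: ennpowr_ennreal powr_powr)
    moreover have "ennreal (U + V) = ?L + ?R"
      using t' u v UV by (simp add: U_def V_def ennpowr_ennreal ennreal_mult)
    ultimately show ?thesis by simp
  qed
qed

theorem theorem1p4:
  fixes p t :: real
    and \<mu> :: "'n::finite \<Rightarrow> real measure"
    and \<phi> :: "'n \<Rightarrow> real \<Rightarrow> real"
    and A B :: "(real ^ 'n) set"
  assumes "1 < p" and "t \<in> {0..1}"
    and "\<And>i. quasi_concave (\<phi> i)"
    and "\<And>i x. \<phi> i x \<le> \<phi> i 0"
    and "\<And>i. \<mu> i = density lborel (\<lambda>x. ennreal (\<phi> i x))"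
    and "A \<noteq> {}" and "weakly_unconditional A" and "A \<in> sets lebesgue"
    and "B \<noteq> {}" and "weakly_unconditional B" and "B \<in> sets lebesgue"
    and "Lp_combination p (1 - t) A t B \<in> sets lebesgue"
  shows "ennpowr (emeasure (product_measure \<mu>) (Lp_combination p (1 - t) A t B)) (p / real CARD('n))
    \<ge> ennreal (1 - t) * ennpowr (emeasure (product_measure \<mu>) A) (p / real CARD('n))
      + ennreal t * ennpowr (emeasure (product_measure \<mu>) B) (p / real CARD('n))"
proof -
  let ?P = "product_measure \<mu>"
  have dens: "peaked_density (\<phi> i) (\<mu> i)" for i
    by (rule peaked_density.intro) (rule assms(3-5))+
  have meas: "\<phi> i \<in> borel_measurable borel" for i
    using assms(3) by (rule quasi_concave_borel_measurable)
  have \<mu>: "\<mu> = (\<lambda>i. density lborel (\<lambda>x. ennreal (\<phi> i x)))"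
    by (rule ext) (rule assms(5))
  have lebesgue: "sets lebesgue \<subseteq> sets ?P"
    using sets_lebesgue_subset_product_measure[of \<phi>, OF meas] unfolding \<mu> .
  have null: "N \<in> null_sets ?P" if N: "N \<in> null_sets lebesgue" for N
  proof -
    let ?D = "\<lambda>x :: real ^ 'n. \<Prod>i\<in>UNIV. ennreal (\<phi> i (x $ i))"
    have P: "?P = completion (density lborel ?D)"
      using product_measure_density[of \<phi>, OF meas] unfolding \<mu> .
    have D: "?D \<in> borel_measurable lborel"
      using meas by measurable
    obtain N' where N': "N' \<in> null_sets lborel" "N \<subseteq> N'"
      using N unfolding null_sets_completion_iff2 by blast
    have "N' \<in> null_sets (density lborel ?D)"
      using absolutely_continuousI_density[OF D] N'(1) unfolding absolutely_continuous_def by (rule subsetD)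
    with N'(2) show ?thesis
      unfolding P null_sets_completion_iff2 by blast
  qed
  \<comment> \<open>The product measure is absolutely continuous, so passing to the F-sigma cores loses nothing.\<close>
  have core: "emeasure ?P X = emeasure ?P S"
    if "X \<in> sets lebesgue" "S \<subseteq> X" "fsigma S" "X - S \<in> null_sets lebesgue" for X S
  proof -
    have "emeasure ?P X = emeasure ?P (X - (X - S))"
      using that lebesgue null by (intro emeasure_Diff_null_set[symmetric]) auto
    also have "X - (X - S) = S" using that(2) by blast
    finally show ?thesis .
  qed
  obtain S where S: "fsigma S" "weakly_unconditional S" "S \<noteq> {}" "S \<subseteq> A" "A - S \<in> null_sets lebesgue"
    by (rule weakly_unconditional_fsigma_core[OF assms(8,7,6)])
  obtain T where T: "fsigma T" "weakly_unconditional T" "T \<noteq> {}" "T \<subseteq> B" "B - T \<in> null_sets lebesgue"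
    by (rule weakly_unconditional_fsigma_core[OF assms(11,10,9)])
  have "Lp_combination p (1 - t) S t T \<subseteq> Lp_combination p (1 - t) A t B"
    using S(4) T(4) by (rule Lp_combination_mono)
  moreover have "Lp_combination p (1 - t) A t B \<in> sets ?P"
    using assms(12) lebesgue by blast
  ultimately have "ennreal (1 - t) * ennpowr (emeasure ?P S) (p / real CARD('n))
      + ennreal t * ennpowr (emeasure ?P T) (p / real CARD('n))
    \<le> ennpowr (emeasure ?P (Lp_combination p (1 - t) A t B)) (p / real CARD('n))"
    using assms(1,2) by (intro brunn_minkowski_Lp_fsigma[OF dens _ _ _ S(1-3) T(1-3)]) auto
  then show ?thesis
    by (simp only: core[OF assms(8) S(4,1,5)] core[OF assms(11) T(4,1,5)])
qed

end
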